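(* Let $\varepsilon\in(0,1)$ be fixed and let $p=p(n)$ satisfy $(\log n)^{2+\varepsilon}n^{-1}\le p<n^{-\varepsilon}$. Then there are constants $c_\varepsilon,C_\varepsilon>0$ (depending only on $\varepsilon$) such that, with probability tending to $1$ as $n\to\infty$, \[ c_\varepsilon\,\frac{n^2\log n}{\alpha^2(G_{n,p})}\le \overline{\theta}_1(G_{n,p})\le C_\varepsilon\,\frac{n^2\log n}{\alpha^2(G_{n,p})}. \]
   Context: $G_{n,p}$ denotes the binomial random graph on $n$ vertices in which each pair of vertices is an edge independently with probability $p$. $\alpha(G)$ is the independence number of $G$. $\overline{\theta}_1(G)$ is the minimum number of independent sets of $G$ needed to cover all non-edges of $G$ (i.e. every pair of distinct non-adjacent vertices lies in some chosen independent set). All logarithms are natural. *)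

theory Defs
  imports "HOL-Probability.Probability"
begin

text \<open>A simple graph is given by its vertex set \<open>V\<close> and its edge set \<open>E\<close>, the edges being
  two-element subsets of \<open>V\<close>.\<close>

definition vertex_pairs :: "'a set \<Rightarrow> 'a set set" where
  "vertex_pairs V = {e. e \<subseteq> V \<and> card e = 2}"

definition independent_set :: "'a set \<Rightarrow> 'a set set \<Rightarrow> 'a set \<Rightarrow> bool" where
  "independent_set V E S \<longleftrightarrow> S \<subseteq> V \<and> (\<forall>u\<in>S. \<forall>v\<in>S. {u, v} \<notin> E)"

definition independence_number :: "'a set \<Rightarrow> 'a set set \<Rightarrow> nat" where
  "independence_number V E = Max (card ` {S. independent_set V E S})"

definition covers_non_edges :: "'a set \<Rightarrow> 'a set set \<Rightarrow> 'a set set \<Rightarrow> bool" where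
  "covers_non_edges V E F \<longleftrightarrow>
     (\<forall>u\<in>V. \<forall>v\<in>V. u \<noteq> v \<and> {u, v} \<notin> E \<longrightarrow> (\<exists>S\<in>F. u \<in> S \<and> v \<in> S))"

text \<open>The number \<open>\<theta>\<^sub>1\<close>-bar. For finite \<open>V\<close> the minimum exists: the non-edges themselves,
  as two-element independent sets, form a finite cover.\<close>

definition theta1_bar :: "'a set \<Rightarrow> 'a set set \<Rightarrow> nat" where
  "theta1_bar V E =
     (LEAST k. \<exists>F. finite F \<and> card F = k \<and> (\<forall>S\<in>F. independent_set V E S) \<and> covers_non_edges V E F)"

text \<open>The distribution of the edge set of the binomial random graph on the vertex set
  \<open>{..<n}\<close>. Only meaningful for \<open>0 \<le> p \<le> 1\<close>, since \<^const>\<open>bernoulli_pmf\<close> truncates \<open>p\<close> to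
  that range.\<close>

definition Gnp :: "nat \<Rightarrow> real \<Rightarrow> nat set set pmf" where
  "Gnp n p =
     map_pmf (\<lambda>f. {e \<in> vertex_pairs {..<n}. f e})
       (Pi_pmf (vertex_pairs {..<n}) False (\<lambda>_. bernoulli_pmf p))"

end

theory Submission
  imports Defs "HOL-Real_Asymp.Real_Asymp"
begin

text \<open>
  Write \<open>d = n p\<close> and \<open>L = ln d\<close>. A first moment bound gives \<open>\<alpha> \<le> 6 L / p\<close>.

  Upper bound. Let \<open>l\<close> be about \<open>L / (16 p)\<close>. By Chernoff and a union bound, every set \<open>S\<close> of at most
  \<open>l + 1\<close> vertices has \<open>\<Theta>(n (1 - p)\<^bsup>|S|\<^esup>)\<close> common non-neighbours. This makes the number of independent
  \<open>(l + 2)\<close>-sets at most \<open>O(n\<^sup>2 (1 - p)\<^bsup>2l\<^esup> / l\<^sup>2)\<close> times the number of independent \<open>l\<close>-sets, and it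
  makes every vertex lie in a small fraction of the independent \<open>l\<close>-sets. The edges at two vertices
  \<open>u\<close>, \<open>v\<close> are independent of the rest of the graph, so by a lower tail inequality a fraction
  \<open>\<Omega>((1 - p)\<^bsup>2l\<^esup>)\<close> of the independent \<open>l\<close>-sets avoiding \<open>u\<close>, \<open>v\<close> contain no neighbour of either.
  Hence each non-edge lies in a fraction \<open>\<Omega>(l\<^sup>2 / n\<^sup>2)\<close> of all independent \<open>(l + 2)\<close>-sets, and greedy
  covering needs only \<open>O(n\<^sup>2 ln n / l\<^sup>2)\<close> of them. In particular \<open>\<alpha> \<ge> l + 2\<close>.

  Lower bound. A cover determines the graph. There are at most \<open>d\<^sup>k\<close> vertex sets of size at most \<open>k\<close>,
  hence at most \<open>d\<^bsup>k m\<^esup>\<close> graphs with \<open>\<alpha> \<le> k\<close> and a cover by \<open>m\<close> sets, whereas a graph with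
  \<open>\<Omega>(n\<^sup>2 p)\<close> edges has probability at most \<open>p\<close> to that power and \<open>p \<le> n\<^bsup>-\<epsilon>\<^esup>\<close>.
\<close>

subsection \<open>Random subsets\<close>

text \<open>Expectation over the random subset of \<open>A\<close> that keeps each element
  independently with probability \<open>p\<close>. As a finite sum it makes conditioning and
  splitting of the ground set purely algebraic.\<close>

definition subset_exp :: "real \<Rightarrow> 'a set \<Rightarrow> ('a set \<Rightarrow> real) \<Rightarrow> real" where
  "subset_exp p A f = (\<Sum>R\<in>Pow A. p ^ card R * (1 - p) ^ (card A - card R) * f R)"

abbreviation subset_prob :: "real \<Rightarrow> 'a set \<Rightarrow> ('a set \<Rightarrow> bool) \<Rightarrow> real" where
  "subset_prob p A P \<equiv> subset_exp p A (\<lambda>R. of_bool (P R))"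

lemma subset_exp_empty [simp]: "subset_exp p {} f = f {}"
  by (simp add: subset_exp_def)

lemma subset_exp_cong:
  "(\<And>R. R \<subseteq> A \<Longrightarrow> f R = g R) \<Longrightarrow> subset_exp p A f = subset_exp p A g"
  by (auto simp: subset_exp_def intro!: sum.cong)

lemma subset_exp_mono:
  assumes "0 \<le> p" "p \<le> 1" "\<And>R. R \<subseteq> A \<Longrightarrow> f R \<le> g R"
  shows "subset_exp p A f \<le> subset_exp p A g"
  unfolding subset_exp_def using assms by (intro sum_mono mult_left_mono) auto

lemma subset_exp_add: "subset_exp p A (\<lambda>R. f R + g R) = subset_exp p A f + subset_exp p A g"
  by (simp add: subset_exp_def distrib_left sum.distrib)

lemma subset_exp_cmult: "subset_exp p A (\<lambda>R. c * f R) = c * subset_exp p A f"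
  by (simp add: subset_exp_def sum_distrib_left mult_ac)

lemma subset_exp_sum: "subset_exp p A (\<lambda>R. \<Sum>i\<in>I. f i R) = (\<Sum>i\<in>I. subset_exp p A (f i))"
  unfolding subset_exp_def sum_distrib_left by (rule sum.swap)

text \<open>Case split on whether \<open>a\<close> is kept. This recursion drives the inductions
  over the ground set.\<close>

lemma subset_exp_insert:
  assumes "finite A" "a \<notin> A"
  shows "subset_exp p (insert a A) f
         = p * subset_exp p A (\<lambda>R. f (insert a R)) + (1 - p) * subset_exp p A f"
proof -
  have P: "Pow (insert a A) = Pow A \<union> insert a ` Pow A" by (rule Pow_insert)
  have dis: "Pow A \<inter> insert a ` Pow A = {}" using assms by auto
  have inj: "inj_on (insert a) (Pow A)" using assms unfolding inj_on_def by auto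
  have fin: "finite R" if "R \<subseteq> A" for R using that assms finite_subset by auto
  have 1: "(\<Sum>R\<in>Pow A. p ^ card R * (1 - p) ^ (card (insert a A) - card R) * f R)
      = (1 - p) * subset_exp p A f"
    unfolding subset_exp_def sum_distrib_left
  proof (intro sum.cong refl)
    fix R assume "R \<in> Pow A"
    then have "card R \<le> card A" using assms card_mono by auto
    then show "p ^ card R * (1 - p) ^ (card (insert a A) - card R) * f R =
       (1 - p) * (p ^ card R * (1 - p) ^ (card A - card R) * f R)"
      using assms by (simp add: Suc_diff_le)
  qed
  have 2: "(\<Sum>R\<in>insert a ` Pow A. p ^ card R * (1 - p) ^ (card (insert a A) - card R) * f R)
      = p * subset_exp p A (\<lambda>R. f (insert a R))"
    unfolding subset_exp_def sum_distrib_left sum.reindex[OF inj] o_def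
  proof (intro sum.cong refl)
    fix R assume R: "R \<in> Pow A"
    then have "a \<notin> R" "finite R" using assms fin by auto
    then show "p ^ card (insert a R) * (1 - p) ^ (card (insert a A) - card (insert a R)) *
         f (insert a R) = p * (p ^ card R * (1 - p) ^ (card A - card R) * f (insert a R))"
      using assms by simp
  qed
  show ?thesis
    unfolding subset_exp_def[of p "insert a A"] P
    using 1 2 assms dis by (subst sum.union_disjoint) auto
qed

text \<open>Independence: the traces of the random set on disjoint parts can be drawn one after the
  other.\<close>

lemma subset_exp_Un:
  assumes "finite A" "finite B" "A \<inter> B = {}"
  shows "subset_exp p (A \<union> B) f = subset_exp p A (\<lambda>R. subset_exp p B (\<lambda>R'. f (R \<union> R')))"
  using assms(1,3)
proof (induction A arbitrary: f rule: finite_induct)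
  case (insert a A)
  then show ?case
    using assms(2) by (simp add: subset_exp_insert)
qed simp

lemma subset_exp_const [simp]: "finite A \<Longrightarrow> subset_exp p A (\<lambda>_. c) = c"
  by (induction A rule: finite_induct) (simp_all add: subset_exp_insert algebra_simps)

text \<open>The probability generating function of a binomial variable, the source of the
  exponential moments used below.\<close>

lemma subset_exp_power_card:
  "finite A \<Longrightarrow> subset_exp p A (\<lambda>R. z ^ card R) = (1 - p + p * z) ^ card A"
proof (induction A rule: finite_induct)
  case (insert a A)
  have "subset_exp p A (\<lambda>R. z ^ card (insert a R)) = subset_exp p A (\<lambda>R. z * z ^ card R)"
    using insert.hyps by (intro subset_exp_cong) (auto simp: card_insert_if finite_subset)
  then show ?case
    using insert by (simp add: subset_exp_insert subset_exp_cmult algebra_simps)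
qed simp

text \<open>Conditioned on missing \<open>F\<close>, the random set is a random subset of
  \<open>A - F\<close> with the same \<open>p\<close>.\<close>

lemma subset_exp_avoid:
  assumes "finite A" "F \<subseteq> A"
  shows "subset_exp p A (\<lambda>R. of_bool (F \<inter> R = {}) * f R) = (1 - p) ^ card F * subset_exp p (A - F) f"
proof -
  have "finite F" using assms finite_subset by auto
  have "subset_exp p F (\<lambda>R. of_bool (R = {}) * h R) = (1 - p) ^ card F * h {}" for h :: "'a set \<Rightarrow> real"
    using \<open>finite F\<close> 
  proof (induction F arbitrary: h rule: finite_induct)
    case (insert a F)
    have "subset_exp p F (\<lambda>R. of_bool (insert a R = {}) * h (insert a R)) = 0"
      by (simp add: subset_exp_def)
    then show ?case using insert by (simp add: subset_exp_insert)
  qed simp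
  note H = this
  have "subset_exp p A (\<lambda>R. of_bool (F \<inter> R = {}) * f R)
      = subset_exp p (F \<union> (A - F)) (\<lambda>R. of_bool (F \<inter> R = {}) * f R)"
    using assms by (simp add: Un_absorb1)
  also have "\<dots> = subset_exp p F (\<lambda>R. subset_exp p (A - F) (\<lambda>R'. of_bool (F \<inter> (R \<union> R') = {}) * f (R \<union> R')))"
    using assms \<open>finite F\<close> by (intro subset_exp_Un) auto
  also have "\<dots> = subset_exp p F (\<lambda>R. of_bool (R = {}) * subset_exp p (A - F) (\<lambda>R'. f (R \<union> R')))"
    unfolding subset_exp_cmult[symmetric] 
    by (intro subset_exp_cong arg_cong2[where f = "(*)"] refl arg_cong[where f = of_bool]) auto
  also have "\<dots> = (1 - p) ^ card F * subset_exp p (A - F) f"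
    by (subst H) simp
  finally show ?thesis .
qed

lemma subset_prob_avoid:
  assumes "finite A" "F \<subseteq> A"
  shows "subset_prob p A (\<lambda>R. F \<inter> R = {}) = (1 - p) ^ card F"
  using subset_exp_avoid[OF assms, of p "\<lambda>_. 1"] assms by simp

lemma subset_prob_mono:
  assumes "0 \<le> p" "p \<le> 1" "\<And>R. R \<subseteq> A \<Longrightarrow> P R \<Longrightarrow> Q R"
  shows "subset_prob p A P \<le> subset_prob p A Q"
  using assms by (intro subset_exp_mono) auto

lemma subset_prob_Bex_le:
  assumes "0 \<le> p" "p \<le> 1" "finite I"
  shows "subset_prob p A (\<lambda>R. \<exists>i\<in>I. P i R) \<le> (\<Sum>i\<in>I. subset_prob p A (P i))"
proof -
  have "of_bool (\<exists>i\<in>I. P i R) \<le> (\<Sum>i\<in>I. of_bool (P i R) :: real)" for R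
  proof (cases "\<exists>i\<in>I. P i R")
    case True
    then obtain i where "i \<in> I" "P i R" by auto
    then have "1 = (\<Sum>j\<in>{i}. of_bool (P j R) :: real)" by simp
    also have "\<dots> \<le> (\<Sum>i\<in>I. of_bool (P i R) :: real)"
      using assms \<open>i \<in> I\<close> by (intro sum_mono2) auto
    finally show ?thesis by auto
  qed (simp add: sum_nonneg)
  then show ?thesis
    unfolding subset_exp_sum[symmetric] using assms by (intro subset_exp_mono) auto
qed

lemma subset_prob_disj_le:
  assumes "0 \<le> p" "p \<le> 1"
  shows "subset_prob p A (\<lambda>R. P R \<or> Q R) \<le> subset_prob p A P + subset_prob p A Q"
  unfolding subset_exp_add[symmetric] using assms by (intro subset_exp_mono) auto

lemma subset_prob_not:
  assumes "finite A"
  shows "subset_prob p A (\<lambda>R. \<not> P R) = 1 - subset_prob p A P"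
proof -
  have "subset_prob p A (\<lambda>R. \<not> P R) + subset_prob p A P = subset_exp p A (\<lambda>_. 1)"
    unfolding subset_exp_add[symmetric] by (intro subset_exp_cong) auto
  then show ?thesis using assms by simp
qed

section \<open>The binomial random graph as a random subset of the vertex pairs\<close>

lemma finite_vertex_pairs: "finite V \<Longrightarrow> finite (vertex_pairs V)"
  unfolding vertex_pairs_def by (rule finite_subset[of _ "Pow V"]) auto

lemma prob_bind_bernoulli_pmf:
  assumes "0 \<le> p" "p \<le> 1"
  shows "measure_pmf.prob (bind_pmf (bernoulli_pmf p) N) X
         = p * measure_pmf.prob (N True) X + (1 - p) * measure_pmf.prob (N False) X"
proof -
  have "ennreal (measure_pmf.prob (bind_pmf (bernoulli_pmf p) N) X)
      = ennreal (p * measure_pmf.prob (N True) X + (1 - p) * measure_pmf.prob (N False) X)"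
    using assms
    by (simp add: measure_pmf.emeasure_eq_measure[symmetric] ennreal_plus ennreal_mult 
        nn_integral_bernoulli_pmf mult.commute)
  then show ?thesis
    using assms by (subst (asm) ennreal_inj) auto
qed

text \<open>The bridge from the probability mass function in \<open>Gnp\<close> to finite sums; all
  estimates are made on the side of \<open>subset_prob\<close>.\<close>

lemma prob_bernoulli_subset:
  assumes "finite A" "0 \<le> p" "p \<le> 1"
  shows "measure_pmf.prob (map_pmf (\<lambda>f. {e \<in> A. f e}) (Pi_pmf A False (\<lambda>_. bernoulli_pmf p))) X
         = subset_prob p A (\<lambda>R. R \<in> X)"
  using assms(1)
proof (induction A arbitrary: X rule: finite_induct)
  case empty
  show ?case by (simp add: indicator_def)
next
  case (insert a A)
  let ?M = "Pi_pmf A False (\<lambda>_. bernoulli_pmf p)"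
  have "map_pmf (\<lambda>f. {e \<in> insert a A. f e}) (Pi_pmf (insert a A) False (\<lambda>_. bernoulli_pmf p))
     = bind_pmf (bernoulli_pmf p) (\<lambda>b. map_pmf (\<lambda>f. {e \<in> insert a A. (f(a := b)) e}) ?M)"
    using insert.hyps by (simp add: Pi_pmf_insert' map_bind_pmf map_pmf_def bind_assoc_pmf bind_return_pmf)
  also have "\<dots> = bind_pmf (bernoulli_pmf p)
      (\<lambda>b. map_pmf (\<lambda>R. if b then insert a R else R) (map_pmf (\<lambda>f. {e \<in> A. f e}) ?M))"
    using insert.hyps by (intro bind_pmf_cong refl) (auto simp: pmf.map_comp o_def intro!: map_pmf_cong split: if_splits)
  finally have eq: "map_pmf (\<lambda>f. {e \<in> insert a A. f e}) (Pi_pmf (insert a A) False (\<lambda>_. bernoulli_pmf p)) = \<dots>" .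
  show ?case unfolding eq prob_bind_bernoulli_pmf[OF assms(2,3)]
    using insert.hyps by (simp add: insert.IH subset_exp_insert measure_map_pmf[of _ "map_pmf _ _"] 
        del: measure_map_pmf)
qed

text \<open>With \<open>Q\<close> the fraction of sets \<open>T i\<close> avoided by the random set, \<open>F t = E (exp (- t * Q))\<close>
  satisfies \<open>F' \<le> - (q / e) * F\<close> with \<open>q = (1 - p) ^ r\<close>: conditioning on avoiding one \<open>T i\<close> changes
  \<open>E (exp (- t * Q))\<close> by a factor of at most \<open>e\<close>, because each element lies in few of the sets. Unlike
  Janson's inequality, this is not sensitive to most pairs \<open>T i\<close>, \<open>T j\<close> intersecting.\<close>

lemma avoided_fraction_lower_tail:
  fixes T :: "'i \<Rightarrow> 'a set" and p \<mu> s :: real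
  assumes p: "0 \<le> p" "p \<le> 1" and A: "finite A" and I: "finite I" "I \<noteq> {}"
    and T: "\<And>i. i \<in> I \<Longrightarrow> T i \<subseteq> A" "\<And>i. i \<in> I \<Longrightarrow> card (T i) = r"
    and deg: "\<And>a. a \<in> A \<Longrightarrow> real (card {i \<in> I. a \<in> T i}) \<le> \<mu> * card I"
    and \<mu>: "0 \<le> \<mu>" and s: "0 \<le> s" "s * \<mu> \<le> 1" "2 * p * r * (s * \<mu>) \<le> 1"
  shows "subset_prob p A (\<lambda>R. real (card {i \<in> I. T i \<inter> R = {}}) \<le> (1 - p) ^ r / (2 * exp 1) * card I)
         \<le> exp (- s * (1 - p) ^ r / (2 * exp 1))"
proof -
  define q where "q = (1 - p) ^ r / exp 1"
  define Q where "Q R = real (card {i \<in> I. T i \<inter> R = {}}) / card I" for R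
  define F where "F t = subset_exp p A (\<lambda>R. exp (- t * Q R))" for t
  have cI: "real (card I) > 0" using I by (simp add: card_gt_0_iff)
  have q0: "q \<ge> 0" using p by (simp add: q_def)
  \<comment> \<open>Adding \<open>R'\<close> spoils only those \<open>T i\<close> that meet
    \<open>R'\<close>, and each element of \<open>R'\<close> lies in at most a fraction \<mu> of
    them.\<close>
  have loss: "Q R - \<mu> * card R' \<le> Q (R \<union> R')" if "R' \<subseteq> A" for R R'
  proof -
    have fR: "finite R'" using that A finite_subset by auto
    have "{i \<in> I. T i \<inter> R = {}} \<subseteq> {i \<in> I. T i \<inter> (R \<union> R') = {}} \<union> (\<Union>a\<in>R'. {i \<in> I. a \<in> T i})"
      by auto
    then have "card {i \<in> I. T i \<inter> R = {}}
        \<le> card ({i \<in> I. T i \<inter> (R \<union> R') = {}} \<union> (\<Union>a\<in>R'. {i \<in> I. a \<in> T i}))"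
      using I fR by (intro card_mono) auto
    also have "\<dots> \<le> card {i \<in> I. T i \<inter> (R \<union> R') = {}} + card (\<Union>a\<in>R'. {i \<in> I. a \<in> T i})"
      by (rule card_Un_le)
    also have "card (\<Union>a\<in>R'. {i \<in> I. a \<in> T i}) \<le> (\<Sum>a\<in>R'. card {i \<in> I. a \<in> T i})"
      by (rule card_UN_le[OF fR])
    finally have "real (card {i \<in> I. T i \<inter> R = {}})
        \<le> card {i \<in> I. T i \<inter> (R \<union> R') = {}} + (\<Sum>a\<in>R'. real (card {i \<in> I. a \<in> T i}))"
      by (simp flip: of_nat_sum of_nat_add)
    also have "(\<Sum>a\<in>R'. real (card {i \<in> I. a \<in> T i})) \<le> (\<Sum>a\<in>R'. \<mu> * card I)"
      using that by (intro sum_mono deg) auto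
    finally have "real (card {i \<in> I. T i \<inter> R = {}})
        \<le> card {i \<in> I. T i \<inter> (R \<union> R') = {}} + \<mu> * card R' * card I" by (simp add: mult_ac)
    from divide_right_mono[OF this, of "card I"] show ?thesis
      using cI by (simp add: Q_def add_divide_distrib)
  qed
  \<comment> \<open>Split the random set into its part outside \<open>T i\<close> and its part
    \<open>R'\<close> inside. By \<open>loss\<close>, the latter costs a factor of at most
    \<open>exp (t * \<mu>) ^ card R'\<close>, whose mean is at most
    \<open>exp (2 * p * r * (t * \<mu>))\<close>, hence at most e.\<close>
  have step: "F t \<le> exp 1 * subset_exp p (A - T i) (\<lambda>R. exp (- t * Q R))"
    if i: "i \<in> I" and t: "0 \<le> t" "t \<le> s" for i t
  proof -
    have fT: "finite (T i)" "T i \<subseteq> A" using T[OF i] A finite_subset by auto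
    have tm: "t * \<mu> \<le> s * \<mu>" "0 \<le> t * \<mu>" using t \<mu> by (auto intro: mult_right_mono)
    have e1: "exp (t * \<mu>) \<le> 1 + 2 * (t * \<mu>)"
    proof -
      have "exp (t * \<mu>) \<le> 1 + t * \<mu> + (t * \<mu>)\<^sup>2" using tm s by (intro exp_bound) auto
      also have "(t * \<mu>)\<^sup>2 \<le> t * \<mu>" using tm s
        by (simp add: power2_eq_square mult_left_le)
      finally show ?thesis by linarith
    qed
    have fac: "subset_exp p (T i) (\<lambda>R. exp (t * \<mu>) ^ card R) \<le> exp 1"
    proof -
      have "1 - p + p * exp (t * \<mu>) \<le> 1 + p * (2 * (t * \<mu>))"
        using mult_left_mono[OF e1 p(1)] by (simp add: algebra_simps)
      also have "\<dots> \<le> exp (p * (2 * (t * \<mu>)))" by (rule exp_ge_add_one_self)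
      finally have "(1 - p + p * exp (t * \<mu>)) ^ r \<le> exp (p * (2 * (t * \<mu>))) ^ r"
        using p by (intro power_mono) auto
      also have "\<dots> = exp (2 * p * r * (t * \<mu>))" by (simp add: mult_ac flip: exp_of_nat_mult)
      also have "\<dots> \<le> exp 1"
      proof -
        have "2 * p * r * (t * \<mu>) \<le> 2 * p * r * (s * \<mu>)" using tm p by (intro mult_left_mono) auto
        then show ?thesis using s by simp
      qed
      finally show ?thesis using fT T[OF i] by (simp add: subset_exp_power_card)
    qed
    have "F t = subset_exp p ((A - T i) \<union> T i) (\<lambda>R. exp (- t * Q R))"
      using fT by (simp add: F_def Un_absorb2)
    also have "\<dots> = subset_exp p (A - T i) (\<lambda>R. subset_exp p (T i) (\<lambda>R'. exp (- t * Q (R \<union> R'))))"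
      using A fT by (intro subset_exp_Un) auto
    also have "\<dots> \<le> subset_exp p (A - T i) (\<lambda>R. subset_exp p (T i) (\<lambda>R'. exp (- t * Q R) * exp (t * \<mu>) ^ card R'))"
    proof (intro subset_exp_mono p)
      fix R R' assume "R' \<subseteq> T i"
      then have "Q R - \<mu> * card R' \<le> Q (R \<union> R')" using fT by (intro loss) auto
      then have "- t * Q (R \<union> R') \<le> - t * (Q R - \<mu> * card R')" using t by (simp add: mult_left_mono)
      then have "exp (- t * Q (R \<union> R')) \<le> exp (- t * Q R + card R' * (t * \<mu>))" by (simp add: algebra_simps)
      then show "exp (- t * Q (R \<union> R')) \<le> exp (- t * Q R) * exp (t * \<mu>) ^ card R'"
        by (simp only: exp_add exp_of_nat_mult)
    qed
    also have "\<dots> = subset_exp p (T i) (\<lambda>R. exp (t * \<mu>) ^ card R) * subset_exp p (A - T i) (\<lambda>R. exp (- t * Q R))"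
      by (simp only: subset_exp_cmult mult.commute[of _ "subset_exp p (T i) _"])
    also have "\<dots> \<le> exp 1 * subset_exp p (A - T i) (\<lambda>R. exp (- t * Q R))"
    proof (intro mult_right_mono fac)
      have "0 = subset_exp p (A - T i) (\<lambda>R. 0)" using A by simp
      also have "\<dots> \<le> subset_exp p (A - T i) (\<lambda>R. exp (- t * Q R))" by (intro subset_exp_mono p) auto
      finally show "0 \<le> subset_exp p (A - T i) (\<lambda>R. exp (- t * Q R))" .
    qed
    finally show ?thesis .
  qed
  \<comment> \<open>The right-hand side is the negative derivative of \<open>F\<close> at
    \<open>t\<close>. With \<open>Q\<close> written as an average of avoidance indicators, each
    index contributes \<open>(1 - p) ^ r\<close> times an expectation over \<open>A - T i\<close>,
    and \<open>step\<close> bounds that below by \<open>F t / exp 1\<close>.\<close>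
  have der: "q * F t \<le> subset_exp p A (\<lambda>R. Q R * exp (- t * Q R))" if t: "0 \<le> t" "t \<le> s" for t
  proof -
    have "Q R = (\<Sum>i\<in>I. of_bool (T i \<inter> R = {}) / card I)" for R
      using I by (simp add: Q_def sum_divide_distrib[symmetric] Int_def)
    then have "subset_exp p A (\<lambda>R. Q R * exp (- t * Q R))
       = subset_exp p A (\<lambda>R. \<Sum>i\<in>I. (1 / card I) * (of_bool (T i \<inter> R = {}) * exp (- t * Q R)))"
      by (intro subset_exp_cong) (simp add: sum_distrib_right mult_ac)
    also have "\<dots> = (\<Sum>i\<in>I. (1 / card I) * ((1 - p) ^ r * subset_exp p (A - T i) (\<lambda>R. exp (- t * Q R))))"
      unfolding subset_exp_sum subset_exp_cmult using A T
      by (intro sum.cong refl arg_cong2[where f = "(*)"]) (simp add: subset_exp_avoid)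
    also have "\<dots> \<ge> (\<Sum>i\<in>I. (1 / card I) * ((1 - p) ^ r * (F t / exp 1)))"
      using p step[OF _ t] by (intro sum_mono mult_left_mono) (auto simp: field_simps)
    also have "(\<Sum>i\<in>I. (1 / card I) * ((1 - p) ^ r * (F t / exp 1))) = q * F t"
      using cI by (simp add: q_def)
    finally show ?thesis .
  qed
  \<comment> \<open>Integrates the differential inequality \<open>F' \<le> - q * F\<close> from 0 to
    \<open>s\<close>.\<close>
  have "F s * exp (q * s) \<le> F 0 * exp (q * 0)"
  proof (rule DERIV_nonpos_imp_nonincreasing[OF s(1)])
    fix t assume t: "0 \<le> t" "t \<le> s"
    have "((\<lambda>t. \<Sum>R\<in>Pow A. p ^ card R * (1 - p) ^ (card A - card R) * exp (- t * Q R)) has_real_derivative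
        (\<Sum>R\<in>Pow A. p ^ card R * (1 - p) ^ (card A - card R) * (- (Q R * exp (- t * Q R))))) (at t)"
      by (intro DERIV_sum) (auto intro!: derivative_eq_intros)
    then have dF: "(F has_real_derivative - subset_exp p A (\<lambda>R. Q R * exp (- t * Q R))) (at t)"
      by (simp add: F_def[abs_def] subset_exp_def sum_negf)
    have D: "((\<lambda>t. F t * exp (q * t)) has_real_derivative
       (- subset_exp p A (\<lambda>R. Q R * exp (- t * Q R))) * exp (q * t) + F t * (exp (q * t) * q)) (at t)"
      by (rule derivative_eq_intros dF refl | simp)+
    have "(- subset_exp p A (\<lambda>R. Q R * exp (- t * Q R))) * exp (q * t) + F t * (exp (q * t) * q)
        = (q * F t - subset_exp p A (\<lambda>R. Q R * exp (- t * Q R))) * exp (q * t)"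
      by (simp add: algebra_simps)
    also have "\<dots> \<le> 0" using der[OF t] by (intro mult_nonpos_nonneg) auto
    finally show "\<exists>y. ((\<lambda>t. F t * exp (q * t)) has_real_derivative y) (at t) \<and> y \<le> 0"
      using D by blast
  qed
  moreover have "F 0 = 1" using A by (simp add: F_def)
  ultimately have Fs: "F s \<le> exp (- (q * s))" by (simp add: exp_minus field_simps)
  \<comment> \<open>Markov's inequality for \<open>exp (- s * Q R)\<close> at the threshold
    \<open>q / 2\<close>; this spends half of the decay \<open>exp (- (q * s))\<close>.\<close>
  have "subset_prob p A (\<lambda>R. real (card {i \<in> I. T i \<inter> R = {}}) \<le> (1 - p) ^ r / (2 * exp 1) * card I)
      \<le> subset_exp p A (\<lambda>R. exp (s * q / 2) * exp (- s * Q R))"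
  proof (intro subset_exp_mono p)
    fix R
    show "of_bool (real (card {i \<in> I. T i \<inter> R = {}}) \<le> (1 - p) ^ r / (2 * exp 1) * card I)
       \<le> exp (s * q / 2) * exp (- s * Q R)"
    proof (cases "real (card {i \<in> I. T i \<inter> R = {}}) \<le> (1 - p) ^ r / (2 * exp 1) * card I")
      case True
      then have "Q R \<le> q / 2" using cI by (simp add: Q_def q_def field_simps)
      then have "s * Q R \<le> s * (q / 2)" using s(1) by (rule mult_left_mono)
      then have "exp 0 \<le> exp (s * q / 2 - s * Q R)" by (subst exp_le_cancel_iff) simp
      then show ?thesis using True by (simp flip: exp_add)
    qed simp
  qed
  also have "\<dots> \<le> exp (s * q / 2) * exp (- (q * s))"
    unfolding subset_exp_cmult F_def[symmetric] using Fs by simp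
  also have "\<dots> = exp (- s * (1 - p) ^ r / (2 * exp 1))"
    by (simp flip: exp_add add: q_def field_simps)
  finally show ?thesis .
qed

subsection \<open>Common non-neighbours\<close>

text \<open>For an independent \<open>S\<close> these are the vertices that extend it to a larger
  independent set. The definition makes sense for every \<open>S\<close>, so it can be controlled
  before it is known which sets are independent.\<close>

definition available :: "'a set \<Rightarrow> 'a set set \<Rightarrow> 'a set \<Rightarrow> 'a set" where
  "available V E S = {w \<in> V - S. \<forall>x\<in>S. {w, x} \<notin> E}"

text \<open>For disjoint \<open>F w\<close> the avoidance events are independent, so the count is
  binomial with success probability \<open>(1 - p) ^ s\<close>; the right-hand side is its
  generating function.\<close>

lemma subset_exp_power_card_avoided:
  fixes p z :: real
  assumes A: "finite A" and W: "finite W"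
    and F: "\<And>w. w \<in> W \<Longrightarrow> F w \<subseteq> A" "\<And>w. w \<in> W \<Longrightarrow> card (F w) = s" "disjoint_family_on F W"
  shows "subset_exp p A (\<lambda>R. z ^ card {w \<in> W. F w \<inter> R = {}}) = (1 + (z - 1) * (1 - p) ^ s) ^ card W"
proof -
  have fin: "finite (F w)" if "w \<in> W" for w using F(1)[OF that] A finite_subset by auto
  \<comment> \<open>Expanding \<open>z\<close> to the count as a product of terms
    \<open>1 + (z - 1) * indicator\<close> leaves only probabilities of avoiding a union, which
    disjointness evaluates.\<close>
  have 1: "z ^ card {w \<in> W. F w \<inter> R = {}}
      = (\<Sum>B\<in>Pow W. (z - 1) ^ card B * of_bool ((\<Union>w\<in>B. F w) \<inter> R = {}))" for R
  proof -
    have "z ^ card {w \<in> W. F w \<inter> R = {}} = (\<Prod>w\<in>W. if F w \<inter> R = {} then z else 1)"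
      using W by (simp add: prod.If_cases Int_def)
    also have "\<dots> = (\<Prod>w\<in>W. (z - 1) * of_bool (F w \<inter> R = {}) + 1)"
      by (intro prod.cong) auto
    also have "\<dots> = (\<Sum>B\<in>Pow W. (\<Prod>w\<in>B. (z - 1) * of_bool (F w \<inter> R = {})) * (\<Prod>w\<in>W - B. 1))"
      by (rule prod_add[OF W])
    also have "\<dots> = (\<Sum>B\<in>Pow W. (z - 1) ^ card B * of_bool ((\<Union>w\<in>B. F w) \<inter> R = {}))"
    proof (intro sum.cong refl)
      fix B assume "B \<in> Pow W"
      then have "finite B" using W finite_subset by auto
      then have "(\<Prod>w\<in>B. of_bool (F w \<inter> R = {}) :: real) = of_bool ((\<Union>w\<in>B. F w) \<inter> R = {})"
        by (induction B rule: finite_induct) (auto simp: Int_Un_distrib2)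
      then show "(\<Prod>w\<in>B. (z - 1) * of_bool (F w \<inter> R = {})) * (\<Prod>w\<in>W - B. 1)
          = (z - 1) ^ card B * of_bool ((\<Union>w\<in>B. F w) \<inter> R = {})"
        by (simp add: prod.distrib)
    qed
    finally show ?thesis .
  qed
  have "subset_exp p A (\<lambda>R. z ^ card {w \<in> W. F w \<inter> R = {}})
      = (\<Sum>B\<in>Pow W. (z - 1) ^ card B * (1 - p) ^ card (\<Union>w\<in>B. F w))"
    unfolding 1 subset_exp_sum subset_exp_cmult
    using F(1) A by (intro sum.cong refl arg_cong2[where f = "(*)"] subset_prob_avoid) auto
  also have "\<dots> = (\<Sum>B\<in>Pow W. (\<Prod>w\<in>B. (z - 1) * (1 - p) ^ s) * (\<Prod>w\<in>W - B. 1))"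
  proof (intro sum.cong refl)
    fix B assume B: "B \<in> Pow W"
    then have "finite B" using W finite_subset by auto
    then have "card (\<Union>w\<in>B. F w) = (\<Sum>w\<in>B. card (F w))"
      using B F(3) fin by (intro card_UN_disjoint) (auto simp: disjoint_family_on_def)
    also have "\<dots> = card B * s" using B F(2) by (simp add: subset_iff)
    finally show "(z - 1) ^ card B * (1 - p) ^ card (\<Union>w\<in>B. F w)
        = (\<Prod>w\<in>B. (z - 1) * (1 - p) ^ s) * (\<Prod>w\<in>W - B. 1)"
      by (simp add: power_mult_distrib mult.commute[of "card B"] flip: power_mult)
  qed
  also have "\<dots> = (\<Prod>w\<in>W. (z - 1) * (1 - p) ^ s + 1)"
    by (rule prod_add[OF W, symmetric])
  finally show ?thesis by (simp add: add.commute)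
qed

text \<open>The stars joining different outside vertices to \<open>S\<close> are disjoint and have
  \<open>card S\<close> pairs each, so the number of available vertices is binomial.\<close>

lemma subset_exp_power_card_available:
  assumes V: "finite V" and S: "S \<subseteq> V"
  shows "subset_exp p (vertex_pairs V) (\<lambda>E. z ^ card (available V E S))
         = (1 + (z - 1) * (1 - p) ^ card S) ^ (card V - card S)"
proof -
  define F where "F w = (\<lambda>x. {w, x}) ` S" for w
  have "available V E S = {w \<in> V - S. F w \<inter> E = {}}" for E
    by (auto simp: available_def F_def)
  moreover have "subset_exp p (vertex_pairs V) (\<lambda>E. z ^ card {w \<in> V - S. F w \<inter> E = {}})
     = (1 + (z - 1) * (1 - p) ^ card S) ^ card (V - S)"
  proof (rule subset_exp_power_card_avoided)
    show "finite (vertex_pairs V)" by (rule finite_vertex_pairs[OF V])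
    show "finite (V - S)" using V by simp
    show "F w \<subseteq> vertex_pairs V" if "w \<in> V - S" for w
      using that S by (auto simp: F_def vertex_pairs_def card_insert_if)
    show "card (F w) = card S" if "w \<in> V - S" for w
      unfolding F_def by (rule card_image) (auto simp: inj_on_def doubleton_eq_iff)
    show "disjoint_family_on F (V - S)"
      unfolding disjoint_family_on_def F_def by (auto simp: doubleton_eq_iff)
  qed
  ultimately show ?thesis using V S by (simp add: card_Diff_subset finite_subset)
qed

lemma exp_1_bounds: "2 \<le> exp (1::real)" "exp (1::real) \<le> 3"
  using exp_ge_add_one_self[of 1] exp_le by auto

text \<open>Chernoff bound with \<open>z = exp (-1)\<close>. At least half of \<open>V\<close> lies
  outside \<open>S\<close>, so with \<open>q = (1 - p) ^ card S\<close> the exponent is at most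
  \<open>card V * q / 8 - card V * q / 4\<close>.\<close>

lemma prob_available_small:
  fixes p :: real
  assumes p: "0 \<le> p" "p \<le> 1" and V: "finite V" and S: "S \<subseteq> V" "2 * card S \<le> card V"
  shows "subset_prob p (vertex_pairs V)
           (\<lambda>E. real (card (available V E S)) < card V * (1 - p) ^ card S / 8)
         \<le> exp (- (card V * (1 - p) ^ card S / 8))"
proof -
  define q where "q = (1 - p) ^ card S"
  have q: "0 \<le> q" "q \<le> 1" using p by (auto simp: q_def power_le_one)
  have "subset_prob p (vertex_pairs V) (\<lambda>E. real (card (available V E S)) < card V * q / 8)
     \<le> subset_exp p (vertex_pairs V) (\<lambda>E. exp (card V * q / 8) * exp (-1) ^ card (available V E S))"
  proof (intro subset_exp_mono p)
    fix E
    show "of_bool (real (card (available V E S)) < card V * q / 8)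
       \<le> exp (card V * q / 8) * exp (-1) ^ card (available V E S)"
      by (cases "real (card (available V E S)) < card V * q / 8")
        (auto simp flip: exp_of_nat_mult exp_add)
  qed
  also have "\<dots> = exp (card V * q / 8) * (1 + (exp (-1) - 1) * q) ^ (card V - card S)"
    using subset_exp_power_card_available[OF V S(1), of p "exp (-1)"]
    by (simp add: subset_exp_cmult q_def)
  also have "\<dots> \<le> exp (card V * q / 8) * exp (- (q / 2)) ^ (card V - card S)"
  proof (intro mult_left_mono power_mono)
    have "exp (-1 :: real) \<le> 1 / 2" using exp_1_bounds by (simp add: exp_minus field_simps)
    then have "(exp (-1) - 1) * q \<le> (- 1 / 2) * q" using q by (intro mult_right_mono) auto
    then have "1 + (exp (-1) - 1) * q \<le> 1 + (- (q / 2))" by simp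
    also have "\<dots> \<le> exp (- (q / 2))" by (rule exp_ge_add_one_self)
    finally show "1 + (exp (- 1) - 1) * q \<le> exp (- (q / 2))" .
    have "(1 - exp (-1)) * q \<le> 1 * 1" using q by (intro mult_mono) auto
    then show "0 \<le> 1 + (exp (- 1) - 1) * q" by (simp add: algebra_simps)
  qed auto
  also have "\<dots> = exp (card V * q / 8 - (card V - card S) * (q / 2))"
    by (simp flip: exp_of_nat_mult exp_add)
  also have "\<dots> \<le> exp (- (card V * q / 8))"
  proof -
    have "card V / 2 * (q / 2) \<le> (card V - card S) * (q / 2)"
      using S q by (intro mult_right_mono) auto
    then show ?thesis by simp
  qed
  finally show ?thesis by (simp add: q_def)
qed

text \<open>Chernoff bound with \<open>z = exp 1\<close>. The exponent \<open>-4 + 2 = -2\<close>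
  per unit of \<open>card V * q\<close> is weakened to \<open>- 1 / 8\<close> to match the lower
  tail.\<close>

lemma prob_available_large:
  fixes p :: real
  assumes p: "0 \<le> p" "p \<le> 1" and V: "finite V" and S: "S \<subseteq> V"
  shows "subset_prob p (vertex_pairs V)
           (\<lambda>E. real (card (available V E S)) > 4 * (card V * (1 - p) ^ card S))
         \<le> exp (- (card V * (1 - p) ^ card S / 8))"
proof -
  define q where "q = (1 - p) ^ card S"
  have q: "0 \<le> q" "q \<le> 1" using p by (auto simp: q_def power_le_one)
  have "subset_prob p (vertex_pairs V) (\<lambda>E. real (card (available V E S)) > 4 * (card V * q))
     \<le> subset_exp p (vertex_pairs V) (\<lambda>E. exp (- (4 * (card V * q))) * exp 1 ^ card (available V E S))"
  proof (intro subset_exp_mono p)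
    fix E
    show "of_bool (real (card (available V E S)) > 4 * (card V * q))
       \<le> exp (- (4 * (card V * q))) * exp 1 ^ card (available V E S)"
      by (cases "real (card (available V E S)) > 4 * (card V * q)")
        (auto simp flip: exp_of_nat_mult exp_add)
  qed
  also have "\<dots> = exp (- (4 * (card V * q))) * (1 + (exp 1 - 1) * q) ^ (card V - card S)"
    using subset_exp_power_card_available[OF V S(1), of p "exp 1"]
    by (simp add: subset_exp_cmult q_def)
  also have "\<dots> \<le> exp (- (4 * (card V * q))) * exp (2 * q) ^ (card V - card S)"
  proof (intro mult_left_mono power_mono)
    have "(exp 1 - 1) * q \<le> 2 * q" using q exp_1_bounds by (intro mult_right_mono) auto
    then have "1 + (exp 1 - 1) * q \<le> 1 + 2 * q" by simp
    also have "\<dots> \<le> exp (2 * q)" by (rule exp_ge_add_one_self)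
    finally show "1 + (exp 1 - 1) * q \<le> exp (2 * q)" .
    show "0 \<le> 1 + (exp 1 - 1) * q" using q exp_1_bounds by (intro add_nonneg_nonneg mult_nonneg_nonneg) auto
  qed auto
  also have "\<dots> = exp (- (4 * (card V * q)) + (card V - card S) * (2 * q))"
    by (simp flip: exp_of_nat_mult exp_add)
  also have "\<dots> \<le> exp (- (card V * q / 8))"
  proof -
    have "(card V - card S) * (2 * q) \<le> card V * (2 * q)"
      using S q by (intro mult_right_mono) auto
    moreover have "0 \<le> card V * q" using q by simp
    ultimately show ?thesis by simp
  qed
  finally show ?thesis by (simp add: q_def)
qed

lemma prob_few_edges:
  fixes p :: real
  assumes p: "0 \<le> p" "p \<le> 1" and A: "finite A"
  shows "subset_prob p A (\<lambda>E. real (card E) < p * card A / 4) \<le> exp (- (p * card A / 4))"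
proof -
  have "subset_prob p A (\<lambda>E. real (card E) < p * card A / 4)
     \<le> subset_exp p A (\<lambda>E. exp (p * card A / 4) * exp (-1) ^ card E)"
  proof (intro subset_exp_mono p)
    fix E
    show "of_bool (real (card E) < p * card A / 4) \<le> exp (p * card A / 4) * exp (-1) ^ card E"
      by (cases "real (card E) < p * card A / 4") (auto simp flip: exp_of_nat_mult exp_add)
  qed
  also have "\<dots> = exp (p * card A / 4) * (1 - p + p * exp (-1)) ^ card A"
    using A by (simp add: subset_exp_cmult subset_exp_power_card)
  also have "\<dots> \<le> exp (p * card A / 4) * exp (- (p / 2)) ^ card A"
  proof (intro mult_left_mono power_mono)
    have "exp (-1 :: real) \<le> 1 / 2" using exp_1_bounds by (simp add: exp_minus field_simps)
    then have "p * exp (-1) \<le> p * (1 / 2)" using p by (intro mult_left_mono) auto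
    then have "1 - p + p * exp (-1) \<le> 1 + (- (p / 2))" by simp
    also have "\<dots> \<le> exp (- (p / 2))" by (rule exp_ge_add_one_self)
    finally show "1 - p + p * exp (-1) \<le> exp (- (p / 2))" .
  qed (use p in auto)
  also have "\<dots> = exp (- (p * card A / 4))"
    by (simp flip: exp_of_nat_mult exp_add)
  finally show ?thesis .
qed

text \<open>Give \<open>S\<close> the weight \<open>x ^ card S\<close> with
  \<open>x = k / card V \<le> 1\<close>. The sets counted weigh at least \<open>x ^ k\<close> each,
  and all subsets together weigh \<open>(1 + x) ^ card V\<close>, which is at most
  \<open>exp 1 ^ k\<close>.\<close>

lemma card_subsets_card_le:
  assumes V: "finite V" and k: "0 < k" "k \<le> card V"
  shows "real (card {S. S \<subseteq> V \<and> card S \<le> k}) \<le> (exp 1 * card V / k) ^ k"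
proof -
  define x where "x = real k / card V"
  have x: "0 < x" "x \<le> 1" "card V > 0" using k by (auto simp: x_def field_simps)
  have "real (card {S. S \<subseteq> V \<and> card S \<le> k}) * x ^ k = (\<Sum>S | S \<subseteq> V \<and> card S \<le> k. x ^ k)" by simp
  also have "\<dots> \<le> (\<Sum>S | S \<subseteq> V \<and> card S \<le> k. x ^ card S)"
    using x by (intro sum_mono power_decreasing) auto
  also have "\<dots> \<le> (\<Sum>S\<in>Pow V. x ^ card S)"
    using V x by (intro sum_mono2) auto
  also have "\<dots> = (\<Sum>S\<in>Pow V. (\<Prod>w\<in>S. x) * (\<Prod>w\<in>V - S. 1))" by simp
  also have "\<dots> = (\<Prod>w\<in>V. x + 1)" by (rule prod_add[OF V, symmetric])
  also have "\<dots> = (1 + x) ^ card V" by (simp add: add.commute)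
  also have "\<dots> \<le> exp x ^ card V" using x by (intro power_mono exp_ge_add_one_self) auto
  also have "\<dots> = exp 1 ^ k" using x by (simp add: x_def flip: exp_of_nat_mult)
  finally have "real (card {S. S \<subseteq> V \<and> card S \<le> k}) \<le> exp 1 ^ k / x ^ k"
    using x by (simp add: field_simps)
  also have "\<dots> = (exp 1 * card V / k) ^ k" by (simp add: x_def flip: power_divide)
  finally show ?thesis .
qed

subsection \<open>Counting independent sets\<close>

definition independent_sets_of_card :: "'a set \<Rightarrow> 'a set set \<Rightarrow> nat \<Rightarrow> 'a set set" where
  "independent_sets_of_card V E l = {S. independent_set V E S \<and> card S = l}"

lemma finite_independent_sets_of_card: "finite V \<Longrightarrow> finite (independent_sets_of_card V E l)"
  unfolding independent_sets_of_card_def independent_set_def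
  by (rule finite_subset[of _ "Pow V"]) auto

lemma independent_set_subset: "independent_set V E S \<Longrightarrow> T \<subseteq> S \<Longrightarrow> independent_set V E T"
  by (auto simp: independent_set_def)

text \<open>Double counting of pairs of an independent set of size \<open>Suc l\<close> and one of
  its elements: deleting the element leaves an independent \<open>l\<close>-set for which it is
  available.\<close>

lemma Suc_mult_card_independent_sets:
  assumes V: "finite V" and E: "\<And>e. e \<in> E \<Longrightarrow> card e = 2"
  shows "Suc l * card (independent_sets_of_card V E (Suc l))
         = (\<Sum>S\<in>independent_sets_of_card V E l. card (available V E S))"
proof -
  let ?J = "independent_sets_of_card V E"
  define f where "f = (\<lambda>(S, w::'a). (insert w S, w))"
  have fin: "finite S" if "S \<in> ?J m" for S m
    using that V by (auto simp: independent_sets_of_card_def independent_set_def intro: finite_subset)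
  \<comment> \<open>\<open>independent_set\<close> also tests \<open>u = v\<close>, so loops have to
    be excluded.\<close>
  have single: "{w} \<notin> E" for w using E[of "{w}"] by auto
  have "bij_betw f (Sigma (?J l) (available V E)) (Sigma (?J (Suc l)) (\<lambda>S. S))"
  proof (rule bij_betw_byWitness[where f' = "\<lambda>(S, w). (S - {w}, w)"])
    show "\<forall>a\<in>Sigma (?J l) (available V E). (\<lambda>(S, w). (S - {w}, w)) (f a) = a"
      by (auto simp: f_def available_def)
    show "\<forall>a\<in>Sigma (?J (Suc l)) (\<lambda>S. S). f ((\<lambda>(S, w). (S - {w}, w)) a) = a"
      by (auto simp: f_def)
    show "f ` Sigma (?J l) (available V E) \<subseteq> Sigma (?J (Suc l)) (\<lambda>S. S)"
    proof safe
      fix S w T x assume a: "S \<in> ?J l" "w \<in> available V E S" "(T, x) = f (S, w)"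
      have "card T = Suc l" using fin[OF a(1)] a by (auto simp: f_def available_def independent_sets_of_card_def)
      moreover have "independent_set V E T"
        using a single by (auto simp: f_def available_def independent_sets_of_card_def independent_set_def insert_commute)
      ultimately show "T \<in> ?J (Suc l)" "x \<in> T" using a by (auto simp: independent_sets_of_card_def f_def)
    qed
    show "(\<lambda>(S, w). (S - {w}, w)) ` Sigma (?J (Suc l)) (\<lambda>S. S) \<subseteq> Sigma (?J l) (available V E)"
      by (auto simp: available_def independent_sets_of_card_def independent_set_def)
  qed
  then have "card (Sigma (?J l) (available V E)) = card (Sigma (?J (Suc l)) (\<lambda>S. S))"
    by (rule bij_betw_same_card)
  moreover have "card (Sigma (?J l) (available V E)) = (\<Sum>S\<in>?J l. card (available V E S))"
    using V by (intro card_SigmaI finite_independent_sets_of_card) (auto simp: available_def)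
  moreover have "card (Sigma (?J (Suc l)) (\<lambda>S. S)) = (\<Sum>S\<in>?J (Suc l). card S)"
    using V fin by (intro card_SigmaI finite_independent_sets_of_card) auto
  moreover have "\<dots> = Suc l * card (?J (Suc l))"
    by (simp add: independent_sets_of_card_def)
  ultimately show ?thesis by simp
qed

lemma card_independent_sets_growth_ge:
  fixes M :: real
  assumes V: "finite V" and E: "\<And>e. e \<in> E \<Longrightarrow> card e = 2"
    and M: "\<And>S. S \<subseteq> V \<Longrightarrow> card S = l \<Longrightarrow> M \<le> card (available V E S)"
  shows "M * card (independent_sets_of_card V E l) \<le> Suc l * card (independent_sets_of_card V E (Suc l))"
proof -
  have "M * card (independent_sets_of_card V E l) = (\<Sum>S\<in>independent_sets_of_card V E l. M)" by simp
  also have "\<dots> \<le> (\<Sum>S\<in>independent_sets_of_card V E l. real (card (available V E S)))"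
    by (intro sum_mono M) (auto simp: independent_sets_of_card_def independent_set_def)
  also have "\<dots> = real (Suc l * card (independent_sets_of_card V E (Suc l)))"
    by (subst Suc_mult_card_independent_sets[OF V E]) auto
  finally show ?thesis by simp
qed

lemma card_independent_sets_growth_le:
  fixes M :: real
  assumes V: "finite V" and E: "\<And>e. e \<in> E \<Longrightarrow> card e = 2"
    and M: "\<And>S. S \<subseteq> V \<Longrightarrow> card S = l \<Longrightarrow> card (available V E S) \<le> M"
  shows "Suc l * card (independent_sets_of_card V E (Suc l)) \<le> M * card (independent_sets_of_card V E l)"
proof -
  have "real (Suc l * card (independent_sets_of_card V E (Suc l)))
      = (\<Sum>S\<in>independent_sets_of_card V E l. real (card (available V E S)))"
    by (subst Suc_mult_card_independent_sets[OF V E]) auto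
  also have "\<dots> \<le> (\<Sum>S\<in>independent_sets_of_card V E l. M)"
    by (intro sum_mono M) (auto simp: independent_sets_of_card_def independent_set_def)
  finally show ?thesis by (simp add: mult.commute)
qed

text \<open>The growth inequality keeps the number of independent sets positive from size 0 up to
  \<open>l\<close>.\<close>

lemma independent_sets_of_card_nonempty:
  fixes M :: real
  assumes V: "finite V" and E: "\<And>e. e \<in> E \<Longrightarrow> card e = 2" and M0: "0 < M"
    and M: "\<And>S. S \<subseteq> V \<Longrightarrow> card S < l \<Longrightarrow> M \<le> card (available V E S)"
  shows "independent_sets_of_card V E l \<noteq> {}"
  using M
proof (induction l)
  case 0
  have "{} \<in> independent_sets_of_card V E 0" by (simp add: independent_sets_of_card_def independent_set_def)
  then show ?case by auto
next
  case (Suc l)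
  have "0 < card (independent_sets_of_card V E l)"
    using Suc finite_independent_sets_of_card[OF V] by (simp add: card_gt_0_iff)
  then have "0 < M * card (independent_sets_of_card V E l)" using M0 by simp
  also have "\<dots> \<le> Suc l * card (independent_sets_of_card V E (Suc l))"
    using Suc.prems by (intro card_independent_sets_growth_ge[OF V E]) auto
  finally have "card (independent_sets_of_card V E (Suc l)) \<noteq> 0" by (intro notI) simp
  then show ?case by auto
qed

lemma card_independent_sets_containing:
  assumes V: "finite V"
  shows "card {S \<in> independent_sets_of_card V E (Suc l). w \<in> S} \<le> card (independent_sets_of_card V E l)"
proof (rule card_inj_on_le[where f = "\<lambda>S. S - {w}"])
  show "inj_on (\<lambda>S. S - {w}) {S \<in> independent_sets_of_card V E (Suc l). w \<in> S}"
    by (auto simp: inj_on_def)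
  show "(\<lambda>S. S - {w}) ` {S \<in> independent_sets_of_card V E (Suc l). w \<in> S} \<subseteq> independent_sets_of_card V E l"
    by (auto simp: independent_sets_of_card_def independent_set_def)
qed (rule finite_independent_sets_of_card[OF V])

text \<open>Deleting \<open>w\<close> is injective into the independent sets one smaller, and by the
  growth inequality these number at most \<open>l / M\<close> times the independent
  \<open>l\<close>-sets. This supplies the \<mu> of the lower tail inequality.\<close>

lemma card_independent_sets_containing_le_fraction:
  fixes M :: real
  assumes V: "finite V" and E: "\<And>e. e \<in> E \<Longrightarrow> card e = 2" and M0: "0 < M" and l: "0 < l"
    and M: "\<And>S. S \<subseteq> V \<Longrightarrow> card S < l \<Longrightarrow> M \<le> card (available V E S)"
  shows "card {S \<in> independent_sets_of_card V E l. w \<in> S} \<le> l / M * card (independent_sets_of_card V E l)"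
proof -
  obtain m where m: "l = Suc m" using l gr0_implies_Suc by auto
  have "M * card {S \<in> independent_sets_of_card V E (Suc m). w \<in> S} \<le> M * card (independent_sets_of_card V E m)"
    using card_independent_sets_containing[OF V] M0 by (intro mult_left_mono) auto
  also have "\<dots> \<le> Suc m * card (independent_sets_of_card V E (Suc m))"
    using M m by (intro card_independent_sets_growth_ge[OF V E]) auto
  finally show ?thesis using M0 by (simp add: m field_simps)
qed

text \<open>The pairs that, besides \<open>{u, v}\<close>, must be non-edges for \<open>u\<close>
  and \<open>v\<close> to extend an independent \<open>S\<close>.\<close>

definition star_pairs :: "'a \<Rightarrow> 'a \<Rightarrow> 'a set \<Rightarrow> 'a set set" where
  "star_pairs u v S = (\<lambda>w. {u, w}) ` S \<union> (\<lambda>w. {v, w}) ` S"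

lemma card_star_pairs:
  assumes "finite S" "u \<notin> S" "v \<notin> S" "u \<noteq> v"
  shows "card (star_pairs u v S) = 2 * card S"
proof -
  have "inj_on (\<lambda>w. {x, w}) S" for x by (auto simp: inj_on_def doubleton_eq_iff)
  then have "card ((\<lambda>w. {x, w}) ` S) = card S" for x by (rule card_image)
  moreover have "(\<lambda>w. {u, w}) ` S \<inter> (\<lambda>w. {v, w}) ` S = {}"
    using assms by (auto simp: doubleton_eq_iff)
  ultimately show ?thesis using assms by (simp add: star_pairs_def card_Un_disjoint)
qed

lemma card_independent_sets_containing_pair_ge:
  assumes V: "finite V" and E: "\<And>e. e \<in> E \<Longrightarrow> card e = 2" and uv: "u \<in> V" "v \<in> V" "u \<noteq> v" "{u, v} \<notin> E"
  shows "card {S \<in> independent_sets_of_card (V - {u, v}) E l. star_pairs u v S \<inter> E = {}}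
         \<le> card {S \<in> independent_sets_of_card V E (l + 2). u \<in> S \<and> v \<in> S}"
proof (rule card_inj_on_le[where f = "\<lambda>S. insert u (insert v S)"])
  show "inj_on (\<lambda>S. insert u (insert v S)) {S \<in> independent_sets_of_card (V - {u, v}) E l. star_pairs u v S \<inter> E = {}}"
  proof (rule inj_onI)
    fix S T
    assume "S \<in> {S \<in> independent_sets_of_card (V - {u, v}) E l. star_pairs u v S \<inter> E = {}}"
      "T \<in> {S \<in> independent_sets_of_card (V - {u, v}) E l. star_pairs u v S \<inter> E = {}}"
      and eq: "insert u (insert v S) = insert u (insert v T)"
    then have "S \<subseteq> V - {u, v}" "T \<subseteq> V - {u, v}"
      by (auto simp: independent_sets_of_card_def independent_set_def)
    then show "S = T" using eq by blast
  qed
  show "(\<lambda>S. insert u (insert v S)) ` {S \<in> independent_sets_of_card (V - {u, v}) E l. star_pairs u v S \<inter> E = {}}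
      \<subseteq> {S \<in> independent_sets_of_card V E (l + 2). u \<in> S \<and> v \<in> S}"
  proof (rule image_subsetI)
    fix S assume S: "S \<in> {S \<in> independent_sets_of_card (V - {u, v}) E l. star_pairs u v S \<inter> E = {}}"
    then have S1: "S \<subseteq> V - {u, v}" "card S = l" "\<forall>x\<in>S. \<forall>y\<in>S. {x, y} \<notin> E"
      by (auto simp: independent_sets_of_card_def independent_set_def)
    have S2: "{u, w} \<notin> E \<and> {v, w} \<notin> E" if "w \<in> S" for w
      using S that unfolding star_pairs_def by blast
    have "finite S" using S1 V finite_subset by blast
    have "{w} \<notin> E" for w using E[of "{w}"] by auto
    then have "independent_set V E (insert u (insert v S))"
      using S1 S2 uv unfolding independent_set_def by (auto simp: insert_commute)
    moreover have "card (insert u (insert v S)) = l + 2"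
      using S1 \<open>finite S\<close> uv by (auto simp: card_insert_if)
    ultimately show "insert u (insert v S) \<in> {S \<in> independent_sets_of_card V E (l + 2). u \<in> S \<and> v \<in> S}"
      by (simp add: independent_sets_of_card_def)
  qed
qed (simp add: finite_independent_sets_of_card[OF V])

text \<open>First reveal all pairs outside the star \<open>B\<close> of \<open>u\<close> and
  \<open>v\<close>: this fixes \<open>J\<close>. The pairs in \<open>B\<close> are still random, so
  the lower tail inequality applies to the sets \<open>star_pairs u v S\<close> with
  \<open>r = 2 * l\<close>. The conditions on \<open>J\<close> are part of the event, so that
  nothing remains to be shown for a bad \<open>J\<close>.\<close>

lemma prob_pair_rarely_extendable:
  fixes p \<mu> s :: real
  assumes p: "0 \<le> p" "p \<le> 1" and V: "finite V" and uv: "u \<in> V" "v \<in> V" "u \<noteq> v"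
    and \<mu>: "0 \<le> \<mu>" and s: "0 \<le> s" "s * \<mu> \<le> 1" "4 * p * l * (s * \<mu>) \<le> 1"
  defines "J \<equiv> \<lambda>E. independent_sets_of_card (V - {u, v}) E l"
  shows "subset_prob p (vertex_pairs V)
     (\<lambda>E. J E \<noteq> {} \<and> (\<forall>w\<in>V - {u, v}. card {S \<in> J E. w \<in> S} \<le> \<mu> * card (J E)) \<and>
          card {S \<in> J E. star_pairs u v S \<inter> E = {}} \<le> (1 - p) ^ (2 * l) / (2 * exp 1) * card (J E))
     \<le> exp (- s * (1 - p) ^ (2 * l) / (2 * exp 1))" (is "subset_prob p _ ?P \<le> ?r")
proof -
  define A where "A = vertex_pairs V"
  define B where "B = star_pairs u v (V - {u, v})"
  have fA: "finite A" unfolding A_def by (rule finite_vertex_pairs[OF V])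
  have "card {u, w} = 2 \<and> card {v, w} = 2" if "w \<in> V - {u, v}" for w using that by auto
  then have BA: "B \<subseteq> A" using uv unfolding A_def B_def star_pairs_def vertex_pairs_def by blast
  have fB: "finite B" using fA BA finite_subset by auto
  have Bx: "{x, y} \<notin> B" if "x \<in> V - {u, v}" "y \<in> V - {u, v}" for x y
  proof -
    have "u \<in> e \<or> v \<in> e" if "e \<in> B" for e using that by (auto simp: B_def star_pairs_def)
    then show ?thesis using that by blast
  qed
  have inner: "subset_prob p B (\<lambda>R. ?P (E \<union> R)) \<le> ?r" if E: "E \<subseteq> A - B" for E
  proof (cases "J E \<noteq> {} \<and> (\<forall>w\<in>V - {u, v}. card {S \<in> J E. w \<in> S} \<le> \<mu> * card (J E))")
    case True
    have JB: "S \<subseteq> V - {u, v}" "finite S" "card S = l" if "S \<in> J E" for S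
      using that V by (auto simp: J_def independent_sets_of_card_def independent_set_def intro: finite_subset)
    have st: "star_pairs u v S \<subseteq> B" if "S \<in> J E" for S
      using JB[OF that] by (auto simp: B_def star_pairs_def)
    have JU: "J (E \<union> R) = J E" if R: "R \<subseteq> B" for R
    proof -
      have "{x, y} \<in> E \<union> R \<longleftrightarrow> {x, y} \<in> E" if "x \<in> V - {u, v}" "y \<in> V - {u, v}" for x y
        using Bx[OF that] R by auto
      then show ?thesis unfolding J_def independent_sets_of_card_def independent_set_def by blast
    qed
    have "subset_prob p B (\<lambda>R. ?P (E \<union> R))
        \<le> subset_prob p B (\<lambda>R. card {S \<in> J E. star_pairs u v S \<inter> R = {}}
              \<le> (1 - p) ^ (2 * l) / (2 * exp 1) * card (J E))"
    proof (intro subset_prob_mono p)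
      fix R assume R: "R \<subseteq> B" and P: "?P (E \<union> R)"
      have "{S \<in> J E. star_pairs u v S \<inter> (E \<union> R) = {}} = {S \<in> J E. star_pairs u v S \<inter> R = {}}"
        using st E by blast
      then show "card {S \<in> J E. star_pairs u v S \<inter> R = {}} \<le> (1 - p) ^ (2 * l) / (2 * exp 1) * card (J E)"
        using P unfolding JU[OF R] by simp
    qed
    also have "\<dots> \<le> ?r"
    proof (rule avoided_fraction_lower_tail[OF p fB _ _ _ _ _ \<mu> s(1,2)])
      show "finite (J E)" unfolding J_def using V by (intro finite_independent_sets_of_card) auto
      show "J E \<noteq> {}" using True by simp
      show "star_pairs u v S \<subseteq> B" if "S \<in> J E" for S by (rule st[OF that])
      show "card (star_pairs u v S) = 2 * l" if "S \<in> J E" for S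
        using JB[OF that] uv by (subst card_star_pairs) auto
      show "card {S \<in> J E. a \<in> star_pairs u v S} \<le> \<mu> * card (J E)" if a: "a \<in> B" for a
      proof -
        obtain x w where xw: "x \<in> {u, v}" "w \<in> V - {u, v}" "a = {x, w}"
          using a unfolding B_def star_pairs_def by blast
        \<comment> \<open>A star pair \<open>{x, w}\<close> determines its end \<open>w\<close>
          outside \<open>{u, v}\<close>, so the degree of a pair is bounded by the frequency of a
          vertex.\<close>
        have "w \<in> S" if "S \<in> J E" "a \<in> star_pairs u v S" for S
          using that JB[OF that(1)] xw by (auto simp: star_pairs_def doubleton_eq_iff)
        then have "{S \<in> J E. a \<in> star_pairs u v S} \<subseteq> {S \<in> J E. w \<in> S}" by auto
        then have "card {S \<in> J E. a \<in> star_pairs u v S} \<le> card {S \<in> J E. w \<in> S}"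
          using V by (intro card_mono) (auto simp: J_def finite_independent_sets_of_card)
        then show ?thesis using True xw(2) by force
      qed
      show "2 * p * (2 * l) * (s * \<mu>) \<le> 1" using s(3) by (simp add: mult_ac)
    qed
    finally show ?thesis .
  next
    case False
    have "subset_prob p B (\<lambda>R. ?P (E \<union> R)) \<le> subset_prob p B (\<lambda>R. False)"
    proof (intro subset_prob_mono p)
      fix R assume R: "R \<subseteq> B" and P: "?P (E \<union> R)"
      have "{x, y} \<in> E \<union> R \<longleftrightarrow> {x, y} \<in> E" if "x \<in> V - {u, v}" "y \<in> V - {u, v}" for x y
        using Bx[OF that] R by auto
      then have "J (E \<union> R) = J E" unfolding J_def independent_sets_of_card_def independent_set_def by blast
      then show False using P False by simp
    qed
    also have "\<dots> = 0" using fB by simp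
    finally show ?thesis by (rule order_trans) simp
  qed
  have "subset_prob p A ?P = subset_exp p ((A - B) \<union> B) (\<lambda>E. of_bool (?P E))"
    using BA by (simp add: Un_absorb2)
  also have "\<dots> = subset_exp p (A - B) (\<lambda>E. subset_prob p B (\<lambda>R. ?P (E \<union> R)))"
    using fA fB by (intro subset_exp_Un) auto
  also have "\<dots> \<le> subset_exp p (A - B) (\<lambda>_. ?r)"
    by (intro subset_exp_mono p inner)
  also have "\<dots> = ?r" using fA by simp
  finally show ?thesis by (simp add: A_def)
qed

subsection \<open>Covers by independent sets\<close>

text \<open>Greedy covering: an average member of the family covers a fraction \<open>f\<close> of whatever is
  still uncovered.\<close>

lemma exists_small_cover:
  fixes f :: real
  assumes P: "finite P" and J: "finite J" "J \<noteq> {}" and f: "0 \<le> f" "f \<le> 1"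
    and cov: "\<And>x. x \<in> P \<Longrightarrow> f * card J \<le> card {S \<in> J. C S x}"
  shows "\<exists>F\<subseteq>J. card F \<le> m \<and> card {x \<in> P. \<forall>S\<in>F. \<not> C S x} \<le> (1 - f) ^ m * card P"
proof (induction m)
  case 0
  show ?case by (intro exI[of _ "{}"]) auto
next
  case (Suc m)
  then obtain F where F: "F \<subseteq> J" "card F \<le> m"
    "real (card {x \<in> P. \<forall>S\<in>F. \<not> C S x}) \<le> (1 - f) ^ m * card P" by auto
  define U where "U = {x \<in> P. \<forall>S\<in>F. \<not> C S x}"
  have fU: "finite U" using P by (simp add: U_def)
  have "\<exists>S\<in>J. f * card U \<le> card {x \<in> U. C S x}"
  proof (rule ccontr)
    assume "\<not> ?thesis"
    then have "(\<Sum>S\<in>J. real (card {x \<in> U. C S x})) < (\<Sum>S\<in>J. f * card U)"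
      using J by (intro sum_strict_mono) auto
    moreover have "(\<Sum>S\<in>J. real (card {x \<in> U. C S x})) = (\<Sum>S\<in>J. \<Sum>x\<in>U. of_bool (C S x))"
      using fU by (simp add: Int_def)
    moreover have "\<dots> = (\<Sum>x\<in>U. \<Sum>S\<in>J. of_bool (C S x))" by (rule sum.swap)
    moreover have "\<dots> = (\<Sum>x\<in>U. real (card {S \<in> J. C S x}))" using J by (simp add: Int_def)
    moreover have "\<dots> \<ge> (\<Sum>x\<in>U. f * card J)" by (intro sum_mono cov) (auto simp: U_def)
    ultimately show False by (simp add: mult_ac)
  qed
  then obtain S where S: "S \<in> J" "f * card U \<le> card {x \<in> U. C S x}" by auto
  have "card (insert S F) \<le> Suc m" using F(2) card_insert_le_m1[of "Suc m" F S] by simp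
  moreover have "real (card {x \<in> P. \<forall>S\<in>insert S F. \<not> C S x}) \<le> (1 - f) ^ Suc m * card P"
  proof -
    have "{x \<in> P. \<forall>S\<in>insert S F. \<not> C S x} = U - {x \<in> U. C S x}" by (auto simp: U_def)
    then have "real (card {x \<in> P. \<forall>S\<in>insert S F. \<not> C S x}) = card U - real (card {x \<in> U. C S x})"
      using fU by (simp add: card_Diff_subset card_mono of_nat_diff)
    also have "\<dots> \<le> (1 - f) * card U" using S(2) by (simp add: algebra_simps)
    also have "\<dots> \<le> (1 - f) * ((1 - f) ^ m * card P)" using F(3) f by (intro mult_left_mono) (auto simp: U_def)
    finally show ?thesis by (simp add: mult_ac)
  qed
  ultimately show ?case using F(1) S(1) by (intro exI[of _ "insert S F"]) auto
qed

lemma theta1_bar_le: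
  assumes "finite F" "\<And>S. S \<in> F \<Longrightarrow> independent_set V E S" "covers_non_edges V E F"
  shows "theta1_bar V E \<le> card F"
  unfolding theta1_bar_def using assms by (intro Least_le exI[of _ F]) auto

text \<open>The family of all independent sets is a cover, since every non-edge is itself an
  independent set; hence the \<open>LEAST\<close> has a witness.\<close>

lemma theta1_bar_attained:
  assumes V: "finite V" and E: "\<And>e. e \<in> E \<Longrightarrow> card e = 2"
  shows "\<exists>F. finite F \<and> card F = theta1_bar V E \<and> (\<forall>S\<in>F. independent_set V E S) \<and> covers_non_edges V E F"
proof -
  define F where "F = {S. independent_set V E S}"
  have "finite F" unfolding F_def independent_set_def by (rule finite_subset[of _ "Pow V"]) (use V in auto)
  moreover have "covers_non_edges V E F"
    unfolding covers_non_edges_def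
  proof (intro ballI impI)
    fix u v assume "u \<in> V" "v \<in> V" "u \<noteq> v \<and> {u, v} \<notin> E"
    then have "independent_set V E {u, v}"
      using E[of "{u}"] E[of "{v}"] by (auto simp: independent_set_def insert_commute)
    then show "\<exists>S\<in>F. u \<in> S \<and> v \<in> S" by (intro bexI[of _ "{u, v}"]) (auto simp: F_def)
  qed
  ultimately have "\<exists>k F. finite F \<and> card F = k \<and> (\<forall>S\<in>F. independent_set V E S) \<and> covers_non_edges V E F"
    by (auto simp: F_def)
  then show ?thesis unfolding theta1_bar_def by (rule LeastI_ex)
qed

text \<open>After \<open>m\<close> greedy steps at most
  \<open>(1 - f) ^ m * (card V)\<^sup>2\<close> ordered non-edges are uncovered. This is below 1,
  hence 0, once \<open>m\<close> strictly exceeds \<open>2 * ln (card V) / f\<close>.\<close>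

lemma theta1_bar_le_of_fraction:
  fixes f :: real
  assumes V: "finite V" and n: "2 \<le> card V" and f: "0 < f" "f \<le> 1"
    and J: "J \<noteq> {}" "\<And>S. S \<in> J \<Longrightarrow> independent_set V E S"
    and cov: "\<And>u v. u \<in> V \<Longrightarrow> v \<in> V \<Longrightarrow> u \<noteq> v \<Longrightarrow> {u, v} \<notin> E \<Longrightarrow>
        f * card J \<le> card {S \<in> J. u \<in> S \<and> v \<in> S}"
  shows "theta1_bar V E \<le> 2 * ln (card V) / f + 1"
proof -
  define P where "P = {(u, v). u \<in> V \<and> v \<in> V \<and> u \<noteq> v \<and> {u, v} \<notin> E}"
  define m where "m = Suc (nat \<lfloor>2 * ln (card V) / f\<rfloor>)"
  have lnn: "0 \<le> ln (real (card V))" using n by simp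
  have m: "2 * ln (card V) / f < m" "m \<le> 2 * ln (card V) / f + 1"
  proof -
    have "0 \<le> 2 * ln (card V) / f" using f lnn by simp
    then have "real m = of_int \<lfloor>2 * ln (card V) / f\<rfloor> + 1" by (simp add: m_def)
    then show "2 * ln (card V) / f < m" "m \<le> 2 * ln (card V) / f + 1" by linarith+
  qed
  have "J \<subseteq> Pow V" using J(2) unfolding independent_set_def by blast
  then have fJ: "finite J" using V by (simp add: finite_subset)
  have PV: "P \<subseteq> V \<times> V" by (auto simp: P_def)
  then have fP: "finite P" using V finite_subset by blast
  have cP: "card P \<le> card V * card V"
    using card_mono[OF _ PV] V by (simp add: card_cartesian_product)
  have "\<exists>F\<subseteq>J. card F \<le> m \<and> card {x \<in> P. \<forall>S\<in>F. \<not> (fst x \<in> S \<and> snd x \<in> S)} \<le> (1 - f) ^ m * card P"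
    by (rule exists_small_cover[OF fP fJ J(1)]) (use f cov in \<open>auto simp: P_def\<close>)
  then obtain F where F: "F \<subseteq> J" "card F \<le> m"
    "real (card {x \<in> P. \<forall>S\<in>F. \<not> (fst x \<in> S \<and> snd x \<in> S)}) \<le> (1 - f) ^ m * card P" by auto
  have "(1 - f) ^ m * card P \<le> exp (- f) ^ m * (card V * card V)"
    using f cP exp_ge_add_one_self[of "- f"] by (intro mult_mono power_mono) (auto simp flip: of_nat_mult)
  also have "\<dots> = exp (- (m * f)) * exp (2 * ln (card V))"
    using n by (simp add: exp_double power2_eq_square flip: exp_of_nat_mult)
  also have "\<dots> < 1"
    using m f by (simp add: field_simps flip: exp_add)
  finally have "card {x \<in> P. \<forall>S\<in>F. \<not> (fst x \<in> S \<and> snd x \<in> S)} = 0" using F(3) by simp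
  then have "{x \<in> P. \<forall>S\<in>F. \<not> (fst x \<in> S \<and> snd x \<in> S)} = {}" using fP by simp
  then have "covers_non_edges V E F"
    unfolding covers_non_edges_def P_def by fastforce
  then have "theta1_bar V E \<le> card F"
    using F(1) fJ J(2) by (intro theta1_bar_le) (auto intro: finite_subset)
  then show ?thesis using F(2) m by linarith
qed

section \<open>The independence number and the first moment bound\<close>

lemma independence_number_ge:
  assumes "finite V" "independent_set V E S"
  shows "card S \<le> independence_number V E"
  unfolding independence_number_def
proof (rule Max_ge)
  have "finite {S. independent_set V E S}"
    unfolding independent_set_def by (rule finite_subset[of _ "Pow V"]) (use assms in auto)
  then show "finite (card ` {S. independent_set V E S})" by simp
qed (use assms in auto)

lemma independence_number_attained:
  assumes "finite V"
  shows "\<exists>S. independent_set V E S \<and> card S = independence_number V E"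
proof -
  have "finite {S. independent_set V E S}"
    unfolding independent_set_def by (rule finite_subset[of _ "Pow V"]) (use assms in auto)
  moreover have "{} \<in> {S. independent_set V E S}" by (simp add: independent_set_def)
  ultimately have "independence_number V E \<in> card ` {S. independent_set V E S}"
    unfolding independence_number_def by (intro Max_in) auto
  then show ?thesis by auto
qed

lemma independence_number_less:
  assumes V: "finite V" and k: "independent_sets_of_card V E k = {}"
  shows "independence_number V E < k"
proof (rule ccontr)
  assume "\<not> ?thesis"
  moreover obtain S where S: "independent_set V E S" "card S = independence_number V E"
    using independence_number_attained[OF V] by blast
  ultimately have "k \<le> card S" by simp
  then obtain T where "T \<subseteq> S" "card T = k" by (rule obtain_subset_with_card_n)
  then have "T \<in> independent_sets_of_card V E k"
    using independent_set_subset[OF S(1)] by (simp add: independent_sets_of_card_def)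
  then show False using k by simp
qed

lemma card_vertex_pairs: "finite V \<Longrightarrow> card (vertex_pairs V) = card V choose 2"
  unfolding vertex_pairs_def by (rule n_subsets)

text \<open>First moment bound. The \<open>k\<close>-sets are counted among all sets of size at most
  \<open>k\<close>, so that one counting estimate serves throughout.\<close>

lemma prob_independent_set_of_card:
  fixes p :: real
  assumes p: "0 \<le> p" "p \<le> 1" and V: "finite V"
  shows "subset_prob p (vertex_pairs V) (\<lambda>E. independent_sets_of_card V E k \<noteq> {})
         \<le> card {S. S \<subseteq> V \<and> card S \<le> k} * (1 - p) ^ (k choose 2)"
proof -
  let ?X = "{S. S \<subseteq> V \<and> card S = k}"
  have fX: "finite ?X" using V by simp
  have "subset_prob p (vertex_pairs V) (\<lambda>E. independent_sets_of_card V E k \<noteq> {})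
      \<le> subset_prob p (vertex_pairs V) (\<lambda>E. \<exists>S\<in>?X. vertex_pairs S \<inter> E = {})"
  proof (intro subset_prob_mono p)
    fix E assume "E \<subseteq> vertex_pairs V" "independent_sets_of_card V E k \<noteq> {}"
    then obtain S where S: "independent_set V E S" "card S = k" by (auto simp: independent_sets_of_card_def)
    have "vertex_pairs S \<inter> E = {}"
      using S(1) by (auto simp: vertex_pairs_def independent_set_def card_2_iff)
    then show "\<exists>S\<in>?X. vertex_pairs S \<inter> E = {}" using S by (auto simp: independent_set_def)
  qed
  also have "\<dots> \<le> (\<Sum>S\<in>?X. subset_prob p (vertex_pairs V) (\<lambda>E. vertex_pairs S \<inter> E = {}))"
    by (rule subset_prob_Bex_le[OF p fX])
  also have "\<dots> = (\<Sum>S\<in>?X. (1 - p) ^ (k choose 2))"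
  proof (intro sum.cong refl)
    fix S assume "S \<in> ?X"
    then have "finite S" "card S = k" "vertex_pairs S \<subseteq> vertex_pairs V"
      using V by (auto simp: vertex_pairs_def intro: finite_subset)
    then show "subset_prob p (vertex_pairs V) (\<lambda>E. vertex_pairs S \<inter> E = {}) = (1 - p) ^ (k choose 2)"
      using V by (simp add: subset_prob_avoid finite_vertex_pairs card_vertex_pairs)
  qed
  also have "\<dots> = card ?X * (1 - p) ^ (k choose 2)" by simp
  also have "\<dots> \<le> card {S. S \<subseteq> V \<and> card S \<le> k} * (1 - p) ^ (k choose 2)"
    using p V by (intro mult_right_mono) (auto intro!: card_mono)
  finally show ?thesis .
qed

text \<open>A cover of the non-edges by independent sets determines the graph, so few graphs have both
  a small cover and a small independence number.\<close>

lemma prob_small_cover: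
  fixes p b :: real
  assumes p: "0 < p" "p \<le> 1" and V: "finite V"
  shows "subset_prob p (vertex_pairs V) (\<lambda>E. theta1_bar V E \<le> m \<and> independence_number V E \<le> k \<and> b \<le> card E)
         \<le> real (card {S. S \<subseteq> V \<and> card S \<le> k}) ^ m * p powr b"
proof -
  let ?X = "{S. S \<subseteq> V \<and> card S \<le> k}"
  \<comment> \<open>Covers are coded as lists of length exactly \<open>m\<close>; \<open>g\<close>
    decodes a list to the graph whose edges are the pairs contained in no listed set.\<close>
  define Z where "Z = {xs. set xs \<subseteq> ?X \<and> length xs = m}"
  define g where "g xs = {e \<in> vertex_pairs V. \<forall>S\<in>set xs. \<not> e \<subseteq> S}" for xs :: "'a set list"
  have fX: "finite ?X" using V by simp
  have fZ: "finite Z" unfolding Z_def by (rule finite_lists_length_eq[OF fX])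
  have cZ: "card Z = card ?X ^ m" unfolding Z_def by (rule card_lists_length_eq[OF fX])
  have code: "\<exists>xs\<in>Z. E = g xs" if E: "E \<subseteq> vertex_pairs V" and t: "theta1_bar V E \<le> m"
    and a: "independence_number V E \<le> k" for E
  proof -
    have E2: "card e = 2" if "e \<in> E" for e using E that by (auto simp: vertex_pairs_def)
    obtain F where F: "finite F" "card F = theta1_bar V E" "\<And>S. S \<in> F \<Longrightarrow> independent_set V E S"
      "covers_non_edges V E F" using theta1_bar_attained[OF V, of E] E2 by blast
    obtain ys where ys: "set ys = F" "length ys = card F"
      using F(1) by (metis distinct_card finite_distinct_list)
    \<comment> \<open>Padding with the empty set is harmless: it contains no pair, and it has size
      at most \<open>k\<close>.\<close>
    define xs where "xs = ys @ replicate (m - length ys) {}"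
    have xF: "F \<subseteq> set xs" "set xs \<subseteq> insert {} F" using ys by (auto simp: xs_def)
    have "S \<in> ?X" if "S \<in> F" for S
      using independence_number_ge[OF V F(3)[OF that]] F(3)[OF that] a by (auto simp: independent_set_def)
    then have "xs \<in> Z" using xF ys F(2) t by (auto simp: Z_def xs_def)
    moreover have "e \<in> E \<longleftrightarrow> e \<in> g xs" for e
    proof
      assume e: "e \<in> E"
      then obtain x y where xy: "e = {x, y}" "x \<noteq> y" using E2[OF e] by (auto simp: card_2_iff)
      have "\<not> e \<subseteq> S" if "S \<in> set xs" for S
      proof
        assume "e \<subseteq> S"
        then have "S \<in> F" using that xF xy by auto
        then show False using F(3) \<open>e \<subseteq> S\<close> e xy by (auto simp: independent_set_def)
      qed
      then show "e \<in> g xs" using e E by (auto simp: g_def)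
    next
      assume e: "e \<in> g xs"
      then obtain x y where xy: "e = {x, y}" "x \<noteq> y" "x \<in> V" "y \<in> V"
        by (auto simp: g_def vertex_pairs_def card_2_iff)
      show "e \<in> E"
      proof (rule ccontr)
        assume "e \<notin> E"
        then obtain S where "S \<in> F" "x \<in> S" "y \<in> S"
          using F(4) xy unfolding covers_non_edges_def by blast
        then show False using e xy xF by (auto simp: g_def)
      qed
    qed
    ultimately show ?thesis by blast
  qed
  have fA: "finite (vertex_pairs V)" by (rule finite_vertex_pairs[OF V])
  have "subset_prob p (vertex_pairs V) (\<lambda>E. theta1_bar V E \<le> m \<and> independence_number V E \<le> k \<and> b \<le> card E)
     \<le> subset_prob p (vertex_pairs V) (\<lambda>E. \<exists>xs\<in>Z. E = g xs \<and> b \<le> card E)"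
    using p code by (intro subset_prob_mono) auto
  also have "\<dots> \<le> (\<Sum>xs\<in>Z. subset_prob p (vertex_pairs V) (\<lambda>E. E = g xs \<and> b \<le> card E))"
    using p by (intro subset_prob_Bex_le fZ) auto
  also have "\<dots> \<le> (\<Sum>xs\<in>Z. p powr b)"
  proof (intro sum_mono)
    fix xs
    have gA: "g xs \<in> Pow (vertex_pairs V)" by (auto simp: g_def)
    \<comment> \<open>Only one graph contributes, and with at least \<open>b\<close> edges it has
      probability at most \<open>p powr b\<close>.\<close>
    have "subset_prob p (vertex_pairs V) (\<lambda>E. E = g xs \<and> b \<le> card E)
       = (\<Sum>R\<in>{g xs}. p ^ card R * (1 - p) ^ (card (vertex_pairs V) - card R) * of_bool (R = g xs \<and> b \<le> card R))"
      unfolding subset_exp_def using fA gA by (intro sum.mono_neutral_right) auto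
    also have "\<dots> \<le> p powr b"
    proof (cases "b \<le> card (g xs)")
      case True
      have "p ^ card (g xs) * (1 - p) ^ (card (vertex_pairs V) - card (g xs)) \<le> p ^ card (g xs)"
        using p by (intro mult_left_le) (auto intro: power_le_one)
      also have "\<dots> = p powr card (g xs)" using p by (simp add: powr_realpow)
      also have "\<dots> \<le> p powr b" using True p by (intro powr_mono') auto
      finally show ?thesis using True by simp
    qed simp
    finally show "subset_prob p (vertex_pairs V) (\<lambda>E. E = g xs \<and> b \<le> card E) \<le> p powr b" .
  qed
  also have "\<dots> = real (card ?X) ^ m * p powr b" by (simp add: cZ)
  finally show ?thesis .
qed

subsection \<open>Extending independent sets by a pair of vertices\<close>

text \<open>Quantifying over all small \<open>S\<close>, independent or not, allows a direct union
  bound; the factors \<open>1 / 8\<close> and 4 are those of the two Chernoff bounds.\<close>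

definition regular_extensions :: "real \<Rightarrow> nat \<Rightarrow> 'a set \<Rightarrow> 'a set set \<Rightarrow> bool" where
  "regular_extensions p l V E \<longleftrightarrow> (\<forall>S\<subseteq>V. card S \<le> l \<longrightarrow>
     real (card V) * (1 - p) ^ card S / 8 \<le> real (card (available V E S)) \<and>
     real (card (available V E S)) \<le> 4 * (real (card V) * (1 - p) ^ card S))"

text \<open>Union bound over the small sets; since \<open>(1 - p) ^ card S\<close> decreases with
  the size, the weakest tail estimate is the one at size \<open>l\<close>.\<close>

lemma prob_not_regular_extensions:
  fixes p :: real
  assumes p: "0 \<le> p" "p \<le> 1" and V: "finite V" and l: "2 * l \<le> card V"
  shows "subset_prob p (vertex_pairs V) (\<lambda>E. \<not> regular_extensions p l V E)
         \<le> card {S. S \<subseteq> V \<and> card S \<le> l} * (2 * exp (- (card V * (1 - p) ^ l / 8)))"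
proof -
  let ?X = "{S. S \<subseteq> V \<and> card S \<le> l}"
  let ?s = "\<lambda>S E. real (card (available V E S)) < card V * (1 - p) ^ card S / 8"
  let ?t = "\<lambda>S E. real (card (available V E S)) > 4 * (card V * (1 - p) ^ card S)"
  have "subset_prob p (vertex_pairs V) (\<lambda>E. \<not> regular_extensions p l V E)
      \<le> subset_prob p (vertex_pairs V) (\<lambda>E. \<exists>S\<in>?X. ?s S E \<or> ?t S E)"
    by (intro subset_prob_mono p) (auto simp: regular_extensions_def not_le)
  also have "\<dots> \<le> (\<Sum>S\<in>?X. subset_prob p (vertex_pairs V) (\<lambda>E. ?s S E \<or> ?t S E))"
    using V by (intro subset_prob_Bex_le p) simp
  also have "\<dots> \<le> (\<Sum>S\<in>?X. 2 * exp (- (card V * (1 - p) ^ l / 8)))"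
  proof (intro sum_mono)
    fix S assume S: "S \<in> ?X"
    have "subset_prob p (vertex_pairs V) (\<lambda>E. ?s S E \<or> ?t S E)
       \<le> subset_prob p (vertex_pairs V) (?s S) + subset_prob p (vertex_pairs V) (?t S)"
      by (rule subset_prob_disj_le[OF p])
    also have "\<dots> \<le> exp (- (card V * (1 - p) ^ card S / 8)) + exp (- (card V * (1 - p) ^ card S / 8))"
      using S l by (intro add_mono prob_available_small prob_available_large p V) auto
    also have "\<dots> = 2 * exp (- (card V * (1 - p) ^ card S / 8))" by simp
    also have "\<dots> \<le> 2 * exp (- (card V * (1 - p) ^ l / 8))"
    proof -
      have "(1 - p) ^ l \<le> (1 - p) ^ card S" using S p by (intro power_decreasing) auto
      then have "card V * (1 - p) ^ l \<le> card V * (1 - p) ^ card S" by (intro mult_left_mono) auto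
      then show ?thesis by simp
    qed
    finally show "subset_prob p (vertex_pairs V) (\<lambda>E. ?s S E \<or> ?t S E)
       \<le> 2 * exp (- (card V * (1 - p) ^ l / 8))" .
  qed
  finally show ?thesis by simp
qed

text \<open>The parameter \<open>2 * l / M\<close> bounds the probability that a uniformly random independent
  \<open>l\<close>-set of the graph without \<open>u\<close> and \<open>v\<close> contains a given vertex.\<close>

definition rarely_extendable :: "real \<Rightarrow> nat \<Rightarrow> real \<Rightarrow> 'a set \<Rightarrow> 'a set set \<Rightarrow> 'a \<Rightarrow> 'a \<Rightarrow> bool" where
  "rarely_extendable p l M V E u v \<longleftrightarrow>
     (let J = independent_sets_of_card (V - {u, v}) E l in
        J \<noteq> {} \<and> (\<forall>w\<in>V - {u, v}. real (card {S \<in> J. w \<in> S}) \<le> 2 * real l / M * real (card J)) \<and>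
        real (card {S \<in> J. star_pairs u v S \<inter> E = {}}) \<le> (1 - p) ^ (2 * l) / (2 * exp 1) * real (card J))"

lemma prob_some_pair_rarely_extendable:
  fixes p M :: real
  assumes p: "0 < p" "p \<le> 1" and V: "finite V" and M: "0 < M" and l: "1 \<le> 4 * (p * real l)"
  shows "subset_prob p (vertex_pairs V) (\<lambda>E. \<exists>u\<in>V. \<exists>v\<in>V. u \<noteq> v \<and> rarely_extendable p l M V E u v)
         \<le> (card V)\<^sup>2 * exp (- (M / (8 * p * (real l)\<^sup>2)) * (1 - p) ^ (2 * l) / (2 * exp 1))"
proof -
  let ?X = "{(u, v). u \<in> V \<and> v \<in> V \<and> u \<noteq> v}"
  let ?r = "exp (- (M / (8 * p * (real l)\<^sup>2)) * (1 - p) ^ (2 * l) / (2 * exp 1))"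
  have X: "?X \<subseteq> V \<times> V" by auto
  then have fX: "finite ?X" using V finite_subset by blast
  have cX: "card ?X \<le> (card V)\<^sup>2"
    using card_mono[OF _ X] V by (simp add: card_cartesian_product power2_eq_square)
  have l0: "l > 0" using l by (intro gr0I) simp
  have "subset_prob p (vertex_pairs V) (\<lambda>E. \<exists>u\<in>V. \<exists>v\<in>V. u \<noteq> v \<and> rarely_extendable p l M V E u v)
     \<le> subset_prob p (vertex_pairs V) (\<lambda>E. \<exists>x\<in>?X. rarely_extendable p l M V E (fst x) (snd x))"
    using p by (intro subset_prob_mono) auto
  also have "\<dots> \<le> (\<Sum>x\<in>?X. subset_prob p (vertex_pairs V) (\<lambda>E. rarely_extendable p l M V E (fst x) (snd x)))"
    using p by (intro subset_prob_Bex_le fX) auto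
  also have "\<dots> \<le> (\<Sum>x\<in>?X. ?r)"
  proof (intro sum_mono)
    fix x assume x: "x \<in> ?X"
    \<comment> \<open>The tail inequality is used with \<open>s = M / (8 * p * l\<^sup>2)\<close>
      and \<open>\<mu> = 2 * l / M\<close>. Then \<open>4 * p * l * (s * \<mu>)\<close> equals 1,
      and \<open>s * \<mu> \<le> 1\<close> is the assumption on \<open>l\<close>.\<close>
    have eq: "M / (8 * p * (real l)\<^sup>2) * (2 * real l / M) = 1 / (4 * (p * real l))"
      using M p l0 by (simp add: field_simps power2_eq_square)
    show "subset_prob p (vertex_pairs V) (\<lambda>E. rarely_extendable p l M V E (fst x) (snd x)) \<le> ?r"
      unfolding rarely_extendable_def Let_def
    proof (rule prob_pair_rarely_extendable[OF _ p(2) V])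
      show "M / (8 * p * (real l)\<^sup>2) * (2 * real l / M) \<le> 1" unfolding eq using l by simp
      show "4 * p * real l * (M / (8 * p * (real l)\<^sup>2) * (2 * real l / M)) \<le> 1" unfolding eq using l by simp
    qed (use x p M in auto)
  qed
  also have "\<dots> = card ?X * ?r" by simp
  also have "\<dots> \<le> (card V)\<^sup>2 * ?r" using cX by (intro mult_right_mono) (auto simp flip: of_nat_power)
  finally show ?thesis .
qed

text \<open>Compares independent \<open>(l + 2)\<close>-sets with \<open>l\<close>-sets by two
  growth steps, then with \<open>l\<close>-sets avoiding \<open>u\<close> and \<open>v\<close>, then
  with the extendable ones among these. The constant 192 is \<open>4 * 4\<close> from growth, times
  2 for avoiding \<open>u\<close> and \<open>v\<close>, times \<open>2 * 3\<close>, which bounds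
  \<open>2 * exp 1\<close>.\<close>

lemma pair_in_many_independent_sets:
  fixes p M :: real
  assumes p: "0 \<le> p" "p < 1" and V: "finite V" and E: "\<And>e. e \<in> E \<Longrightarrow> card e = 2"
    and reg: "regular_extensions p (l + 1) V E" and l: "0 < l"
    and M: "M = card V * (1 - p) ^ (l + 1) / 8" "4 \<le> M" "4 * l \<le> M"
    and uv: "u \<in> V" "v \<in> V" "u \<noteq> v" "{u, v} \<notin> E" and ext: "\<not> rarely_extendable p l M V E u v"
  defines "J \<equiv> independent_sets_of_card V E"
  shows "(real l)\<^sup>2 / (192 * (real (card V))\<^sup>2) * card (J (l + 2)) \<le> card {S \<in> J (l + 2). u \<in> S \<and> v \<in> S}"
proof -
  define V' where "V' = V - {u, v}"
  define J' where "J' = independent_sets_of_card V' E l"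
  define q where "q = (1 - p) ^ (2 * l)"
  define n where "n = real (card V)"
  have fV': "finite V'" using V by (simp add: V'_def)
  have n0: "n > 0" using M by (cases "card V = 0") (auto simp: n_def)
  have avail: "M \<le> card (available V E S)" if "S \<subseteq> V" "card S \<le> l + 1" for S
  proof -
    have "(1 - p) ^ (l + 1) \<le> (1 - p) ^ card S" using that p by (intro power_decreasing) auto
    then have "M \<le> real (card V) * (1 - p) ^ card S / 8" unfolding M(1) by (intro divide_right_mono mult_left_mono) auto
    also have "\<dots> \<le> card (available V E S)" using reg that unfolding regular_extensions_def by blast
    finally show ?thesis .
  qed
  \<comment> \<open>Removing \<open>u\<close> and \<open>v\<close> loses at most two available
    vertices, and \<open>4 \<le> M\<close> leaves at least half of \<open>M\<close>.\<close>
  have avail': "M / 2 \<le> card (available V' E S)" if "S \<subseteq> V'" "card S < l" for S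
  proof -
    have SV: "S \<subseteq> V" using that by (auto simp: V'_def)
    have "available V E S \<subseteq> available V' E S \<union> {u, v}" by (auto simp: available_def V'_def)
    then have "card (available V E S) \<le> card (available V' E S \<union> {u, v})"
      using fV' by (intro card_mono) (auto simp: available_def)
    also have "\<dots> \<le> card (available V' E S) + card {u, v}" by (rule card_Un_le)
    also have "card {u, v} = 2" using uv by simp
    finally have "real (card (available V E S)) \<le> card (available V' E S) + 2" by linarith
    moreover have "M \<le> card (available V E S)" using that SV by (intro avail) auto
    ultimately show ?thesis using M(2) by linarith
  qed
  have J'0: "J' \<noteq> {}" unfolding J'_def
    by (rule independent_sets_of_card_nonempty[OF fV' E, where M = "M / 2"]) (use M avail' in auto)
  have marg: "card {S \<in> J'. w \<in> S} \<le> 2 * real l / M * card J'" for w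
    using card_independent_sets_containing_le_fraction[OF fV' E _ l avail', of w] M(2)
    unfolding J'_def by (simp add: mult.commute)
  \<comment> \<open>\<open>J'\<close> satisfies the first two clauses of
    \<open>rarely_extendable\<close>, so the third one must fail.\<close>
  have many: "q / (2 * exp 1) * card J' \<le> card {S \<in> J'. star_pairs u v S \<inter> E = {}}"
    using ext J'0 marg unfolding rarely_extendable_def Let_def V'_def[symmetric] J'_def[symmetric] q_def
    by (meson linear)
  have fJ: "finite (J k)" for k unfolding J_def by (rule finite_independent_sets_of_card[OF V])
  \<comment> \<open>Since \<open>4 * l \<le> M\<close>, each of \<open>u\<close> and
    \<open>v\<close> lies in at most a quarter of the independent \<open>l\<close>-sets.\<close>
  have half: "card (J l) \<le> 2 * real (card J')"
  proof -
    have one: "card {S \<in> J l. w \<in> S} \<le> card (J l) / 4" for w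
    proof -
      have "card {S \<in> J l. w \<in> S} \<le> l / M * card (J l)" unfolding J_def
        by (rule card_independent_sets_containing_le_fraction[OF V E _ l]) (use M avail in auto)
      also have "\<dots> \<le> 1 / 4 * card (J l)" using M by (intro mult_right_mono) (auto simp: field_simps)
      finally show ?thesis by simp
    qed
    have "J l \<subseteq> J' \<union> {S \<in> J l. u \<in> S} \<union> {S \<in> J l. v \<in> S}"
      by (auto simp: J_def J'_def V'_def independent_sets_of_card_def independent_set_def)
    then have "card (J l) \<le> card (J' \<union> {S \<in> J l. u \<in> S} \<union> {S \<in> J l. v \<in> S})"
      using fJ[of l] fV' by (intro card_mono) (auto simp: J'_def finite_independent_sets_of_card)
    also have "\<dots> \<le> card (J' \<union> {S \<in> J l. u \<in> S}) + card {S \<in> J l. v \<in> S}" by (rule card_Un_le)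
    also have "\<dots> \<le> card J' + card {S \<in> J l. u \<in> S} + card {S \<in> J l. v \<in> S}"
      by (intro add_right_mono card_Un_le)
    finally have "real (card (J l)) \<le> card J' + real (card {S \<in> J l. u \<in> S}) + real (card {S \<in> J l. v \<in> S})"
      by linarith
    then show ?thesis using one[of u] one[of v] by linarith
  qed
  \<comment> \<open>The two growth steps contribute \<open>(1 - p) ^ (l + 1)\<close> and
    \<open>(1 - p) ^ l\<close>; their product is \<open>q\<close> times a spare factor
    \<open>1 - p\<close>, bounded by 1.\<close>
  have "(real l)\<^sup>2 * card (J (l + 2)) \<le> real (l + 1) * (real (l + 2) * card (J (l + 2)))"
    unfolding power2_eq_square mult.assoc by (intro mult_mono mult_nonneg_nonneg) auto
  also have "\<dots> \<le> real (l + 1) * (4 * (n * (1 - p) ^ (l + 1)) * card (J (l + 1)))"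
  proof (intro mult_left_mono)
    have "Suc (l + 1) * card (J (Suc (l + 1))) \<le> 4 * (n * (1 - p) ^ (l + 1)) * card (J (l + 1))"
      unfolding J_def n_def using reg
      by (intro card_independent_sets_growth_le[OF V E]) (auto simp: regular_extensions_def)
    then show "real (l + 2) * card (J (l + 2)) \<le> 4 * (n * (1 - p) ^ (l + 1)) * card (J (l + 1))"
      by (simp add: distrib_right)
  qed simp
  also have "\<dots> = 4 * (n * (1 - p) ^ (l + 1)) * (real (l + 1) * card (J (l + 1)))" by (simp add: mult_ac)
  also have "\<dots> \<le> 4 * (n * (1 - p) ^ (l + 1)) * (4 * (n * (1 - p) ^ l) * card (J l))"
  proof (intro mult_left_mono)
    have "Suc l * card (J (Suc l)) \<le> 4 * (n * (1 - p) ^ l) * card (J l)"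
      unfolding J_def n_def using reg
      by (intro card_independent_sets_growth_le[OF V E]) (auto simp: regular_extensions_def)
    then show "real (l + 1) * card (J (l + 1)) \<le> 4 * (n * (1 - p) ^ l) * card (J l)"
      by (simp add: distrib_right)
  qed (use p n0 in auto)
  also have "\<dots> = 16 * n\<^sup>2 * q * ((1 - p) * card (J l))"
    by (simp add: q_def power2_eq_square power_mult power_mult_distrib mult_ac flip: power_add)
  also have "\<dots> \<le> 16 * n\<^sup>2 * q * (2 * real (card J'))"
  proof (intro mult_left_mono)
    have "(1 - p) * card (J l) \<le> 1 * real (card (J l))" using p by (intro mult_right_mono) auto
    then show "(1 - p) * card (J l) \<le> 2 * real (card J')" using half by linarith
  qed (use p in \<open>auto simp: q_def\<close>)
  also have "\<dots> = 32 * n\<^sup>2 * (2 * exp 1) * (q / (2 * exp 1) * card J')" by simp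
  also have "\<dots> \<le> 32 * n\<^sup>2 * (2 * exp 1) * card {S \<in> J'. star_pairs u v S \<inter> E = {}}"
    using many by (intro mult_left_mono) auto
  also have "\<dots> \<le> 32 * n\<^sup>2 * (2 * 3) * card {S \<in> J (l + 2). u \<in> S \<and> v \<in> S}"
    unfolding J_def J'_def V'_def using card_independent_sets_containing_pair_ge[OF V E uv, of l] exp_1_bounds
    by (intro mult_mono) auto
  finally show ?thesis using n0 by (simp add: n_def[symmetric] field_simps)
qed

subsection \<open>The sparse regime\<close>

lemma one_minus_ge_exp:
  fixes p :: real
  assumes "0 \<le> p" "p \<le> 1 / 2"
  shows "exp (- (2 * p)) \<le> 1 - p"
proof -
  have "1 \<le> (1 - p) * (1 + 2 * p)"
    using mult_nonneg_nonneg[of p "1 - 2 * p"] assms by (simp add: algebra_simps)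
  also have "\<dots> \<le> (1 - p) * exp (2 * p)"
    using assms by (intro mult_left_mono exp_ge_add_one_self) auto
  finally show ?thesis by (simp add: exp_minus field_simps)
qed

lemma power_one_minus_ge_exp:
  fixes p :: real
  assumes "0 \<le> p" "p \<le> 1 / 2"
  shows "exp (- (2 * (p * real k))) \<le> (1 - p) ^ k"
proof -
  have "exp (- (2 * (p * real k))) = exp (- (2 * p)) ^ k"
    by (simp add: mult_ac flip: exp_of_nat_mult)
  also have "\<dots> \<le> (1 - p) ^ k"
    using one_minus_ge_exp[OF assms] by (intro power_mono) auto
  finally show ?thesis .
qed

text \<open>As \<open>p * k\<close> is at least e, the base \<open>exp 1 * card V / k\<close> is at
  most the degree parameter \<open>card V * p\<close>.\<close>

lemma card_small_subsets_le_exp: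
  fixes p :: real
  assumes V: "finite V" and k: "0 < k" "k \<le> card V" and e: "3 \<le> p * real k" and d: "0 < card V * p"
  shows "real (card {S. S \<subseteq> V \<and> card S \<le> k}) \<le> exp (ln (card V * p) * k)"
proof -
  have "real (card {S. S \<subseteq> V \<and> card S \<le> k}) \<le> (exp 1 * card V / k) ^ k"
    by (rule card_subsets_card_le[OF V k])
  also have "\<dots> \<le> (card V * p) ^ k"
  proof (intro power_mono)
    have "exp 1 * card V \<le> (p * k) * card V"
      using e exp_1_bounds by (intro mult_right_mono) auto
    then show "exp 1 * card V / k \<le> card V * p" using k by (simp add: field_simps)
  qed simp
  also have "\<dots> = exp (ln (card V * p) * k)"
    using d by (simp add: exp_of_nat2_mult)
  finally show ?thesis .
qed

text \<open>The exponent \<open>7 / 8\<close> is what \<open>(1 - p) ^ (l + 1)\<close> leaves of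
  \<open>d\<close>, up to a constant factor; a further \<open>(1 - p) ^ (2 * l)\<close> leaves
  \<open>5 / 8\<close>. The last two clauses let these powers beat the union bounds over small
  vertex sets and over pairs of vertices.\<close>

definition large_degree :: "real \<Rightarrow> bool" where
  "large_degree d \<longleftrightarrow> 16 \<le> d \<and> 100 \<le> ln d \<and> 6 * ln d \<le> d \<and>
     (ln d)\<^sup>2 + ln d + 1 \<le> d powr (7 / 8) / 24 \<and>
     (2 * sqrt d + ln d) * (ln d)\<^sup>2 \<le> 2 / 9 * d powr (5 / 8)"

lemma eventually_large_degree: "\<forall>\<^sub>F d in at_top. large_degree d"
proof -
  have "\<forall>\<^sub>F d::real in at_top. 16 \<le> d" by real_asymp
  moreover have "\<forall>\<^sub>F d::real in at_top. 100 \<le> ln d" by real_asymp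
  moreover have "\<forall>\<^sub>F d::real in at_top. 6 * ln d \<le> d" by real_asymp
  moreover have "\<forall>\<^sub>F d::real in at_top. (ln d)\<^sup>2 + ln d + 1 \<le> d powr (7 / 8) / 24" by real_asymp
  moreover have "\<forall>\<^sub>F d::real in at_top. (2 * sqrt d + ln d) * (ln d)\<^sup>2 \<le> 2 / 9 * d powr (5 / 8)"
    by real_asymp
  ultimately show ?thesis unfolding large_degree_def by eventually_elim blast
qed

text \<open>All asymptotic input for one fixed \<open>n\<close>, so that the estimates below are
  finite inequalities. The lower bound on \<open>p\<close> enters through \<open>d_large\<close>,
  the upper bound through \<open>ln p\<close>.\<close>

locale sparse_regime =
  fixes n :: nat and p \<epsilon> :: real
  assumes eps: "0 < \<epsilon>" "\<epsilon> < 1" and p0: "0 < p" "p \<le> 1 / 2" "ln p \<le> - \<epsilon> * ln n"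
    and n_large: "1 \<le> ln n" "32 \<le> \<epsilon> * n"
    and d_large: "large_degree (n * p)" "ln n \<le> sqrt (n * p)"
begin

text \<open>The independence number lies between \<open>l + 2\<close> and \<open>k\<close>; a cover has more than \<open>m\<close> sets.\<close>

definition "d = n * p"
definition "L = ln d"
definition "l = nat \<lfloor>L / (16 * p)\<rfloor>"
definition "k = nat \<lceil>5 * L / p\<rceil>"
text \<open>For a graph with \<open>regular_extensions p (l + 1)\<close>, the least number of
  vertices available to any set of at most \<open>l + 1\<close> vertices.\<close>

definition "M = real n * (1 - p) ^ (l + 1) / 8"
definition "m = nat \<lfloor>\<epsilon> / 49152 * (256 * ((real n)\<^sup>2 * ln n * p\<^sup>2 / L\<^sup>2))\<rfloor>"
definition "A = vertex_pairs {..<n}"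

lemma d_bounds: "16 \<le> d" "100 \<le> L" "6 * L \<le> d" "L\<^sup>2 + L + 1 \<le> d powr (7 / 8) / 24"
  "(2 * sqrt d + L) * L\<^sup>2 \<le> 2 / 9 * d powr (5 / 8)" "ln n \<le> sqrt d"
  using d_large unfolding large_degree_def d_def L_def by blast+

section \<open>Numerical bounds on the parameters\<close>

lemma exp_L: "exp (- L) = 1 / d"
  using d_bounds(1) by (simp add: L_def exp_minus divide_inverse)

lemma n_pos: "0 < n" using n_large by (intro gr0I) auto

lemma n_ge_d: "2 * d \<le> n"
proof -
  have "n * p \<le> n * (1 / 2)" using p0 by (intro mult_left_mono) auto
  then show ?thesis by (simp add: d_def)
qed

lemma l_bounds: "p * real l \<le> L / 16" "L / 16 < p * real (l + 1)" "L / 32 \<le> p * real l" "0 < l" "2 * (l + 1) \<le> n"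
proof -
  have z: "0 \<le> L / (16 * p)" using d_bounds p0 by simp
  have "real l = of_int \<lfloor>L / (16 * p)\<rfloor>" unfolding l_def using z by simp
  then have "real l \<le> L / (16 * p)" "L / (16 * p) < real l + 1" by linarith+
  then show a: "p * real l \<le> L / 16" and b: "L / 16 < p * real (l + 1)"
    using p0 by (auto simp: field_simps)
  have "p * real (l + 1) = p * real l + p" by (simp add: algebra_simps)
  then show c: "L / 32 \<le> p * real l" using b p0 d_bounds by linarith
  then show "0 < l" using d_bounds by (intro gr0I) auto
  have "p * (2 * real (l + 1)) = 2 * (p * real l) + 2 * p" by (simp add: algebra_simps)
  also have "\<dots> \<le> d" using a p0 d_bounds by linarith
  finally have "p * (2 * real (l + 1)) \<le> p * n" by (simp add: d_def mult.commute)
  then have "2 * real (l + 1) \<le> n" using p0 by simp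
  then show "2 * (l + 1) \<le> n" by linarith
qed

lemma k_bounds: "5 * L \<le> p * real k" "4 * L \<le> p * (real k - 1)" "p * real k \<le> 6 * L" "0 < k" "k \<le> n"
proof -
  have z: "0 \<le> 5 * L / p" using d_bounds p0 by simp
  then have "real k = of_int \<lceil>5 * L / p\<rceil>" unfolding k_def by (simp add: of_nat_nat ceiling_le_iff)
  then have "5 * L / p \<le> real k" "real k < 5 * L / p + 1" by linarith+
  then have a: "5 * L \<le> p * real k" and b: "p * real k < 5 * L + p"
    using p0 by (auto simp: field_simps)
  show "5 * L \<le> p * real k" by fact
  show "4 * L \<le> p * (real k - 1)" using a p0 d_bounds by (simp add: algebra_simps)
  show c: "p * real k \<le> 6 * L" using b p0 d_bounds by linarith
  show "0 < k" using a d_bounds by (intro gr0I) auto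
  have "p * real k \<le> p * n" using c d_bounds by (simp add: d_def mult.commute)
  then show "k \<le> n" using p0 by simp
qed

text \<open>From \<open>p * l \<le> L / 16\<close>, the power \<open>(1 - p) ^ (l + 1)\<close> is at
  least \<open>exp (- (L / 8) - 1)\<close>, that is \<open>d powr (- 1 / 8) / exp 1\<close>; the 24
  bounds \<open>8 * exp 1\<close>.\<close>

lemma M_bounds: "d powr (7 / 8) / 24 \<le> p * M" "4 \<le> M" "4 * real l \<le> M"
proof -
  have "exp (- (L / 8) - 1) \<le> exp (- (2 * (p * real (l + 1))))"
    using l_bounds(1) p0 by (simp add: algebra_simps)
  also have "\<dots> \<le> (1 - p) ^ (l + 1)" using p0 by (intro power_one_minus_ge_exp) auto
  finally have "d * exp (- (L / 8) - 1) / 8 \<le> d * (1 - p) ^ (l + 1) / 8"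
    using d_bounds by (intro divide_right_mono mult_left_mono) auto
  also have "\<dots> = p * M" by (simp add: M_def d_def)
  finally have 1: "d * exp (- (L / 8) - 1) / 8 \<le> p * M" .
  have "d = exp L" using d_bounds by (simp add: L_def)
  then have "d * exp (- (L / 8) - 1) = exp (7 / 8 * L) / exp 1"
    by (simp add: exp_diff[symmetric] flip: exp_add)
  also have "exp (7 / 8 * L) = d powr (7 / 8)" using d_bounds by (simp add: powr_def L_def)
  finally have "d powr (7 / 8) / exp 1 / 8 \<le> p * M" using 1 by simp
  moreover have "d powr (7 / 8) / 24 \<le> d powr (7 / 8) / exp 1 / 8"
    unfolding divide_divide_eq_left using exp_1_bounds by (intro divide_left_mono) auto
  ultimately show a: "d powr (7 / 8) / 24 \<le> p * M" by linarith
  have L2: "0 \<le> L\<^sup>2" by simp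
  have b: "L \<le> p * M" using a d_bounds L2 by linarith
  have "M > 0" using b d_bounds p0 by (smt (verit) mult_nonneg_nonpos)
  then have "p * M \<le> 1 / 2 * M" using p0 by (intro mult_right_mono) auto
  then show "4 \<le> M" using b d_bounds by linarith
  have "p * (4 * real l) \<le> p * M" using b l_bounds(1) d_bounds by linarith
  then show "4 * real l \<le> M" using p0 by simp
qed

section \<open>Probabilities of the five bad events\<close>

lemma prob_irregular: "subset_prob p A (\<lambda>E. \<not> regular_extensions p (l + 1) {..<n} E) \<le> 1 / d"
proof -
  have "subset_prob p A (\<lambda>E. \<not> regular_extensions p (l + 1) {..<n} E)
      \<le> card {S. S \<subseteq> {..<n} \<and> card S \<le> l + 1} * (2 * exp (- (card {..<n} * (1 - p) ^ (l + 1) / 8)))"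
    unfolding A_def using p0 l_bounds by (intro prob_not_regular_extensions) auto
  also have "\<dots> \<le> exp (L * real (l + 1)) * (exp 1 * exp (- M))"
  proof (intro mult_mono)
    have "real (card {S. S \<subseteq> {..<n} \<and> card S \<le> l + 1}) \<le> exp (ln (card {..<n} * p) * real (l + 1))"
      using l_bounds d_bounds p0 n_pos by (intro card_small_subsets_le_exp) auto
    then show "real (card {S. S \<subseteq> {..<n} \<and> card S \<le> l + 1}) \<le> exp (L * real (l + 1))"
      by (simp add: L_def d_def)
  qed (use exp_1_bounds in \<open>auto simp: M_def\<close>)
  also have "\<dots> = exp (L * real (l + 1) + 1 - M)" by (simp flip: exp_add)
  \<comment> \<open>After multiplication by \<open>p\<close> the positive terms are at most
    \<open>L\<^sup>2 / 16 + L + 1 / 2\<close>, whereas \<open>p * M\<close> is at least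
    \<open>d powr (7 / 8) / 24\<close>.\<close>
  also have "\<dots> \<le> exp (- L)"
  proof -
    have "L * (p * real l) \<le> L * (L / 16)" using l_bounds d_bounds by (intro mult_left_mono) auto
    then have "L * (p * real l) \<le> L\<^sup>2 / 16" by (simp add: power2_eq_square)
    moreover have "p * L \<le> 1 / 2 * L" using p0 d_bounds by (intro mult_right_mono) auto
    moreover have "p * (L * real (l + 1) + 1 - M + L) = L * (p * real l) + 2 * (p * L) + p - p * M"
      by (simp add: algebra_simps)
    moreover have "0 \<le> L\<^sup>2" by simp
    ultimately have "p * (L * real (l + 1) + 1 - M + L) \<le> p * 0"
      using M_bounds(1) d_bounds p0 by linarith
    then have "L * real (l + 1) + 1 - M + L \<le> 0" using p0 by (simp only: mult_le_cancel_left_pos)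
    then show ?thesis by simp
  qed
  finally show ?thesis by (simp add: exp_L)
qed

text \<open>There are \<open>exp (2 * ln n)\<close>, hence at most \<open>exp (2 * sqrt d)\<close>,
  ordered pairs, while the tail exponent is of order at least
  \<open>d powr (5 / 8) / L\<^sup>2\<close>. The 16 in \<open>l\<close> is large enough to keep this
  power above \<open>1 / 2\<close>.\<close>

lemma prob_rare_pair:
  "subset_prob p A (\<lambda>E. \<exists>u\<in>{..<n}. \<exists>v\<in>{..<n}. u \<noteq> v \<and> rarely_extendable p l M {..<n} E u v) \<le> 1 / d"
proof -
  have "subset_prob p A (\<lambda>E. \<exists>u\<in>{..<n}. \<exists>v\<in>{..<n}. u \<noteq> v \<and> rarely_extendable p l M {..<n} E u v)
     \<le> (card {..<n})\<^sup>2 * exp (- (M / (8 * p * (real l)\<^sup>2)) * (1 - p) ^ (2 * l) / (2 * exp 1))"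
    unfolding A_def using p0 M_bounds l_bounds d_bounds
    by (intro prob_some_pair_rarely_extendable) auto
  also have "\<dots> \<le> exp (2 * ln n) * exp (- (2 * sqrt d + L))"
  proof (intro mult_mono)
    show "real ((card {..<n})\<^sup>2) \<le> exp (2 * ln n)" using n_pos by (simp add: exp_double)
    have "L > 0" using d_bounds by simp
    have q: "d powr (- (1 / 4)) \<le> (1 - p) ^ (2 * l)"
    proof -
      have "d powr (- (1 / 4)) = exp (- (L / 4))" using d_bounds by (simp add: powr_def L_def)
      also have "\<dots> \<le> exp (- (2 * (p * real (2 * l))))" using l_bounds(1) by simp
      also have "\<dots> \<le> (1 - p) ^ (2 * l)" using p0 by (intro power_one_minus_ge_exp) auto
      finally show ?thesis .
    qed
    have "d powr (7 / 8) / 24 * (32 / L\<^sup>2) \<le> p * M * (1 / (8 * (p * real l)\<^sup>2))"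
    proof (intro mult_mono M_bounds)
      have "(p * real l)\<^sup>2 \<le> (L / 16)\<^sup>2" using l_bounds p0 by (intro power_mono) auto
      then have "8 * (p * real l)\<^sup>2 \<le> L\<^sup>2 / 32" by (simp add: power_divide)
      moreover have "0 < (p * real l)\<^sup>2" using l_bounds p0 by simp
      ultimately have "1 / (L\<^sup>2 / 32) \<le> 1 / (8 * (p * real l)\<^sup>2)"
        using \<open>L > 0\<close> by (intro divide_left_mono mult_pos_pos) auto
      then show "32 / L\<^sup>2 \<le> 1 / (8 * (p * real l)\<^sup>2)" by simp
      show "0 \<le> p * M" using p0 M_bounds by auto
    qed auto
    also have "\<dots> = M / (8 * p * (real l)\<^sup>2)" using p0 l_bounds by (simp add: power_mult_distrib power2_eq_square)
    finally have s: "d powr (7 / 8) / 24 * (32 / L\<^sup>2) \<le> M / (8 * p * (real l)\<^sup>2)" .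
    have "2 * sqrt d + L \<le> 2 / 9 * d powr (5 / 8) / L\<^sup>2"
      using d_bounds(5) \<open>L > 0\<close> by (simp add: field_simps)
    also have "\<dots> = d powr (7 / 8) / 24 * (32 / L\<^sup>2) * d powr (- (1 / 4)) / (2 * 3)"
    proof -
      have "d powr (5 / 8) = d powr (7 / 8) * d powr (- (1 / 4))" by (simp flip: powr_add)
      then show ?thesis by simp
    qed
    also have "\<dots> \<le> M / (8 * p * (real l)\<^sup>2) * (1 - p) ^ (2 * l) / (2 * exp 1)"
      using s q exp_1_bounds p0 M_bounds by (intro frac_le mult_mono) auto
    finally show "exp (- (M / (8 * p * (real l)\<^sup>2)) * (1 - p) ^ (2 * l) / (2 * exp 1)) \<le> exp (- (2 * sqrt d + L))"
      by simp
  qed auto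
  also have "\<dots> \<le> exp (- L)" using d_bounds(6) by (simp flip: exp_add)
  finally show ?thesis by (simp add: exp_L)
qed

text \<open>There are at most \<open>exp (L * k)\<close> candidate sets. Since
  \<open>p * (k - 1) \<ge> 4 * L\<close>, each is independent with probability at most
  \<open>exp (- (2 * L * k))\<close>.\<close>

lemma prob_large_independent_set: "subset_prob p A (\<lambda>E. independent_sets_of_card {..<n} E k \<noteq> {}) \<le> 1 / d"
proof -
  have "subset_prob p A (\<lambda>E. independent_sets_of_card {..<n} E k \<noteq> {})
      \<le> card {S. S \<subseteq> {..<n} \<and> card S \<le> k} * (1 - p) ^ (k choose 2)"
    unfolding A_def using p0 by (intro prob_independent_set_of_card) auto
  also have "\<dots> \<le> exp (L * k) * exp (- (2 * L * k))"
  proof (intro mult_mono)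
    have "real (card {S. S \<subseteq> {..<n} \<and> card S \<le> k}) \<le> exp (ln (card {..<n} * p) * k)"
      using k_bounds d_bounds p0 n_pos by (intro card_small_subsets_le_exp) auto
    then show "real (card {S. S \<subseteq> {..<n} \<and> card S \<le> k}) \<le> exp (L * k)" by (simp add: L_def d_def)
    have "(1 - p) ^ (k choose 2) \<le> exp (- p) ^ (k choose 2)"
      using p0 exp_ge_add_one_self[of "- p"] by (intro power_mono) auto
    also have "\<dots> = exp (- (p * real (k choose 2)))" by (simp add: mult.commute flip: exp_of_nat_mult)
    also have "\<dots> \<le> exp (- (2 * L * k))"
    proof -
      have "real (k choose 2) = real k * (real k - 1) / 2"
        using k_bounds(4) by (simp add: choose_two real_of_nat_div of_nat_diff)
      then have "p * real (k choose 2) = p * (real k - 1) * real k / 2" by (simp only:) simp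
      moreover have "4 * L * k \<le> p * (real k - 1) * real k" using k_bounds by (intro mult_right_mono) auto
      ultimately have "2 * L * k \<le> p * real (k choose 2)" by linarith
      then show ?thesis by simp
    qed
    finally show "(1 - p) ^ (k choose 2) \<le> exp (- (2 * L * k))" .
  qed (use p0 in auto)
  also have "\<dots> = exp (- (L * k))" by (simp flip: exp_add)
  also have "\<dots> \<le> exp (- L)" using k_bounds(4) d_bounds by simp
  finally show ?thesis by (simp add: exp_L)
qed

lemma card_A_ge: "d * n / 16 \<le> p * card A / 4"
proof -
  have "card A = n choose 2" by (simp add: A_def card_vertex_pairs)
  then have "real (card A) = real n * (real n - 1) / 2"
    using n_pos by (simp add: choose_two real_of_nat_div of_nat_diff)
  moreover have "real n * (real n / 2) \<le> real n * (real n - 1)"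
    using n_ge_d d_bounds by (intro mult_left_mono) auto
  ultimately have "real n * real n / 4 \<le> card A" by simp
  then have "p * (real n * real n / 4) \<le> p * card A" using p0 by (intro mult_left_mono) auto
  then show ?thesis by (simp add: d_def mult_ac)
qed

lemma d_n_ge: "L \<le> d * n / 16"
proof -
  have "d * 16 \<le> d * n" using n_ge_d d_bounds by (intro mult_left_mono) auto
  then show ?thesis using d_bounds by linarith
qed

lemma prob_sparse: "subset_prob p A (\<lambda>E. real (card E) < p * card A / 4) \<le> 1 / d"
proof -
  have "subset_prob p A (\<lambda>E. real (card E) < p * card A / 4) \<le> exp (- (p * card A / 4))"
    using p0 by (intro prob_few_edges) (auto simp: A_def finite_vertex_pairs)
  also have "\<dots> \<le> exp (- L)" using order_trans[OF d_n_ge card_A_ge] by simp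
  finally show ?thesis by (simp add: exp_L)
qed

text \<open>At most \<open>exp (L * k * m)\<close> graphs have such a cover, and
  \<open>ln p \<le> - \<epsilon> * ln n\<close> makes each one with enough edges have probability at
  most \<open>exp (- (\<epsilon> * ln n * (d * n / 16)))\<close>.\<close>

lemma prob_small_theta:
  "subset_prob p A (\<lambda>E. theta1_bar {..<n} E \<le> m \<and> independence_number {..<n} E \<le> k \<and> p * card A / 4 \<le> card E) \<le> 1 / d"
proof -
  have "subset_prob p A (\<lambda>E. theta1_bar {..<n} E \<le> m \<and> independence_number {..<n} E \<le> k \<and> p * card A / 4 \<le> card E)
     \<le> real (card {S. S \<subseteq> {..<n} \<and> card S \<le> k}) ^ m * p powr (p * card A / 4)"
    unfolding A_def using p0 by (intro prob_small_cover) auto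
  also have "\<dots> \<le> exp (L * k) ^ m * exp (- (\<epsilon> * ln n * (d * n / 16)))"
  proof (intro mult_mono power_mono)
    have "real (card {S. S \<subseteq> {..<n} \<and> card S \<le> k}) \<le> exp (ln (card {..<n} * p) * k)"
      using k_bounds d_bounds p0 n_pos by (intro card_small_subsets_le_exp) auto
    then show "real (card {S. S \<subseteq> {..<n} \<and> card S \<le> k}) \<le> exp (L * k)" by (simp add: L_def d_def)
    have "p powr (p * card A / 4) = exp (p * card A / 4 * ln p)" using p0 by (simp add: powr_def)
    also have "\<dots> \<le> exp (p * card A / 4 * (- \<epsilon> * ln n))"
      using p0 by (subst exp_le_cancel_iff, intro mult_left_mono) auto
    also have "\<dots> \<le> exp (- (\<epsilon> * ln n * (d * n / 16)))"
      using mult_left_mono[OF card_A_ge, of "\<epsilon> * ln n"] eps n_large by (simp add: mult_ac)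
    finally show "p powr (p * card A / 4) \<le> exp (- (\<epsilon> * ln n * (d * n / 16)))" .
  qed auto
  also have "\<dots> = exp (L * k * m - \<epsilon> * ln n * (d * n / 16))"
    by (simp add: mult_ac flip: exp_of_nat_mult exp_add)
  also have "\<dots> \<le> exp (- L)"
  proof -
    have z: "0 \<le> \<epsilon> / 49152 * (256 * ((real n)\<^sup>2 * ln n * p\<^sup>2 / L\<^sup>2))" using eps n_large by simp
    have "real m \<le> \<epsilon> / 49152 * (256 * ((real n)\<^sup>2 * ln n * p\<^sup>2 / L\<^sup>2))"
      unfolding m_def using z by simp
    moreover have "L * k \<le> 6 * L\<^sup>2 / p"
      using mult_left_mono[OF k_bounds(3), of L] d_bounds p0 by (simp add: field_simps power2_eq_square)
    \<comment> \<open>As \<open>6 * 256 / 49152 = 1 / 32\<close>, coding the covers uses half of the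
      gain \<open>\<epsilon> * ln n * (d * n / 16)\<close>; the other half is at least
      \<open>L\<close>.\<close>
    ultimately have "L * k * m \<le> 6 * L\<^sup>2 / p * (\<epsilon> / 49152 * (256 * ((real n)\<^sup>2 * ln n * p\<^sup>2 / L\<^sup>2)))"
      using z p0 by (intro mult_mono) auto
    also have "\<dots> = \<epsilon> * ln n * (d * n / 32)"
      using p0 d_bounds by (simp add: d_def field_simps power2_eq_square)
    finally have 1: "L * k * m \<le> \<epsilon> * ln n * (d * n / 32)" .
    have "32 * L \<le> \<epsilon> * n * d" using n_large d_bounds eps by (intro mult_mono) auto
    also have "\<dots> = \<epsilon> * n * d * 1" by simp
    also have "\<dots> \<le> \<epsilon> * n * d * ln n" using n_large d_bounds eps by (intro mult_left_mono) auto
    finally have "L \<le> \<epsilon> * ln n * (d * n / 32)" by (simp add: mult_ac)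
    then show ?thesis using 1 by simp
  qed
  finally show ?thesis by (simp add: exp_L)
qed

section \<open>Typical graphs and the two bounds for them\<close>

definition "typical E \<longleftrightarrow> regular_extensions p (l + 1) {..<n} E \<and>
  (\<forall>u\<in>{..<n}. \<forall>v\<in>{..<n}. u \<noteq> v \<longrightarrow> \<not> rarely_extendable p l M {..<n} E u v) \<and>
  independent_sets_of_card {..<n} E k = {} \<and>
  (independence_number {..<n} E \<le> k \<longrightarrow> m < theta1_bar {..<n} E)"

lemma prob_typical: "1 - 5 / d \<le> subset_prob p A typical"
proof -
  define P1 where "P1 E \<longleftrightarrow> \<not> regular_extensions p (l + 1) {..<n} E" for E
  define P2 where "P2 E \<longleftrightarrow> (\<exists>u\<in>{..<n}. \<exists>v\<in>{..<n}. u \<noteq> v \<and> rarely_extendable p l M {..<n} E u v)" for E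
  define P3 where "P3 E \<longleftrightarrow> independent_sets_of_card {..<n} E k \<noteq> {}" for E
  define P4 where "P4 E \<longleftrightarrow> real (card E) < p * card A / 4" for E :: "nat set set"
  define P5 where "P5 E \<longleftrightarrow> theta1_bar {..<n} E \<le> m \<and> independence_number {..<n} E \<le> k \<and> p * card A / 4 \<le> card E" for E
  have p: "0 \<le> p" "p \<le> 1" using p0 by auto
  have "1 - subset_prob p A typical = subset_prob p A (\<lambda>E. \<not> typical E)"
    by (subst subset_prob_not) (auto simp: A_def finite_vertex_pairs)
  \<comment> \<open>If the last clause of \<open>typical\<close> fails, the graph either has few
    edges (\<open>P4\<close>) or is one of the rare graphs counted in \<open>P5\<close>.\<close>
  also have "\<dots> \<le> subset_prob p A (\<lambda>E. P1 E \<or> P2 E \<or> P3 E \<or> P4 E \<or> P5 E)"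
    by (intro subset_prob_mono p) (auto simp: typical_def P1_def P2_def P3_def P4_def P5_def)
  also have "\<dots> \<le> subset_prob p A P1 + (subset_prob p A P2 + (subset_prob p A P3
      + (subset_prob p A P4 + subset_prob p A P5)))"
    by (rule order_trans[OF subset_prob_disj_le[OF p] add_left_mono])+ (rule order_refl)
  also have "\<dots> \<le> 1 / d + (1 / d + (1 / d + (1 / d + 1 / d)))"
    unfolding P1_def P2_def P3_def P4_def P5_def
    by (intro add_mono prob_irregular prob_rare_pair prob_large_independent_set prob_sparse prob_small_theta)
  finally show ?thesis by simp
qed

text \<open>Deterministic part: \<open>l + 2 \<le> \<alpha> < k\<close> places \<alpha> within
  constant factors of \<open>L / p\<close>, which turns the bounds in terms of \<open>m\<close> and
  \<open>l\<close> into bounds in terms of \<alpha>.\<close>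

lemma typical_bounds:
  fixes r :: real
  assumes E: "E \<subseteq> A" and t: "typical E"
  defines "r \<equiv> (real n)\<^sup>2 * ln n / (real (independence_number {..<n} E))\<^sup>2"
  shows "\<epsilon> / 49152 * r \<le> theta1_bar {..<n} E" "theta1_bar {..<n} E \<le> 21233664 * r"
proof -
  let ?V = "{..<n}"
  let ?J = "independent_sets_of_card ?V E (l + 2)"
  define \<alpha> where "\<alpha> = independence_number ?V E"
  have E2: "card e = 2" if "e \<in> E" for e using E that by (auto simp: A_def vertex_pairs_def)
  have reg: "regular_extensions p (l + 1) ?V E" using t by (simp add: typical_def)
  have \<alpha>k: "\<alpha> < k" unfolding \<alpha>_def using t by (intro independence_number_less) (auto simp: typical_def)
  have J0: "?J \<noteq> {}"
  proof (rule independent_sets_of_card_nonempty[OF _ E2, where M = M])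
    fix S assume S: "S \<subseteq> ?V" "card S < l + 2"
    have "(1 - p) ^ (l + 1) \<le> (1 - p) ^ card S" using S p0 by (intro power_decreasing) auto
    then have "M \<le> card ?V * (1 - p) ^ card S / 8"
      unfolding M_def by (auto intro!: divide_right_mono mult_left_mono)
    also have "\<dots> \<le> card (available ?V E S)" using reg S unfolding regular_extensions_def by simp
    finally show "M \<le> card (available ?V E S)" .
  qed (use M_bounds in auto)
  then obtain S where "independent_set ?V E S" "card S = l + 2" by (auto simp: independent_sets_of_card_def)
  then have \<alpha>l: "l + 2 \<le> \<alpha>" using independence_number_ge[of ?V E S] by (simp add: \<alpha>_def)
  have "L / 16 \<le> p * real (l + 1)" using l_bounds(2) by simp
  also have "\<dots> \<le> p * \<alpha>" using \<alpha>l p0 by (intro mult_left_mono) auto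
  finally have La: "L / 16 \<le> p * \<alpha>" .
  have a0: "0 < real \<alpha>" using \<alpha>l by simp
  have "\<epsilon> / 49152 * r \<le> \<epsilon> / 49152 * (256 * ((real n)\<^sup>2 * ln n * p\<^sup>2 / L\<^sup>2))"
  proof (intro mult_left_mono)
    have "(L / 16)\<^sup>2 \<le> (p * \<alpha>)\<^sup>2" using La d_bounds by (intro power_mono) auto
    then have "1 / (real \<alpha>)\<^sup>2 \<le> 256 * p\<^sup>2 / L\<^sup>2" using a0 d_bounds by (simp add: field_simps power_mult_distrib)
    then have "((real n)\<^sup>2 * ln n) * (1 / (real \<alpha>)\<^sup>2) \<le> ((real n)\<^sup>2 * ln n) * (256 * p\<^sup>2 / L\<^sup>2)"
      using n_large by (intro mult_left_mono) auto
    then show "r \<le> 256 * ((real n)\<^sup>2 * ln n * p\<^sup>2 / L\<^sup>2)" by (simp add: r_def \<alpha>_def mult_ac)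
  qed (use eps in auto)
  also have "\<dots> \<le> real m + 1" unfolding m_def by (simp, linarith)
  also have "\<dots> \<le> theta1_bar ?V E" using t \<alpha>k by (simp add: typical_def \<alpha>_def)
  finally show "\<epsilon> / 49152 * r \<le> theta1_bar ?V E" .

  define f where "f = (real l)\<^sup>2 / (192 * (real n)\<^sup>2)"
  have f0: "0 < f" using l_bounds n_pos by (simp add: f_def)
  have f1: "f \<le> 1"
  proof -
    have "(real l)\<^sup>2 \<le> (real n)\<^sup>2" using l_bounds by (intro power_mono) auto
    also have "\<dots> \<le> 192 * (real n)\<^sup>2" by simp
    finally show ?thesis using n_pos by (simp add: f_def)
  qed
  have "theta1_bar ?V E \<le> 2 * ln (card ?V) / f + 1"
  proof (rule theta1_bar_le_of_fraction[where J = ?J, OF _ _ f0 f1 J0])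
    show "2 \<le> card ?V" using l_bounds by simp
    show "independent_set ?V E S" if "S \<in> ?J" for S using that by (simp add: independent_sets_of_card_def)
    fix u v assume uv: "u \<in> ?V" "v \<in> ?V" "u \<noteq> v" "{u, v} \<notin> E"
    have "\<not> rarely_extendable p l M ?V E u v" using t uv by (simp add: typical_def)
    then show "f * card ?J \<le> card {S \<in> ?J. u \<in> S \<and> v \<in> S}"
      using pair_in_many_independent_sets[of p ?V E l M u v] E2 reg l_bounds M_bounds uv p0
      by (simp add: f_def M_def)
  qed simp
  \<comment> \<open>The additive 1 is absorbed because \<open>ln n\<close> is at least 1 and
    \<open>f\<close> at most 1.\<close>
  also have "\<dots> \<le> 3 * ln n / f"
  proof -
    have "1 \<le> ln n / f" using n_large f0 f1 by (simp add: field_simps)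
    then show ?thesis by (simp add: field_simps)
  qed
  also have "\<dots> = 576 * ((real n)\<^sup>2 * ln n) * (1 / (real l)\<^sup>2)" by (simp add: f_def)
  \<comment> \<open>From \<open>p * k \<le> 6 * L\<close> and \<open>L / 32 \<le> p * l\<close> one
    gets \<open>\<alpha> \<le> 192 * l\<close>, and 36864 is the square of 192.\<close>
  also have "\<dots> \<le> 576 * ((real n)\<^sup>2 * ln n) * (36864 / (real \<alpha>)\<^sup>2)"
  proof (intro mult_left_mono)
    have "p * \<alpha> \<le> p * k" using \<alpha>k p0 by simp
    also have "\<dots> \<le> p * (192 * real l)" using k_bounds(3) l_bounds(3) by linarith
    finally have "real \<alpha> \<le> 192 * real l" using p0 by simp
    then have "(real \<alpha>)\<^sup>2 \<le> (192 * real l)\<^sup>2" by (intro power_mono) auto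
    then show "1 / (real l)\<^sup>2 \<le> 36864 / (real \<alpha>)\<^sup>2"
      using a0 l_bounds(4) by (simp add: field_simps power_mult_distrib)
  qed (use n_large in auto)
  finally show "theta1_bar ?V E \<le> 21233664 * r" by (simp add: r_def \<alpha>_def)
qed

end

section \<open>Passage to the limit\<close>

theorem theorem1p2:
  fixes \<epsilon> :: real
  assumes "0 < \<epsilon>" and "\<epsilon> < 1"
  shows "\<exists>c>0. \<exists>C>0. \<forall>p :: nat \<Rightarrow> real.
    (\<forall>\<^sub>F n in sequentially.
       ln (real n) powr (2 + \<epsilon>) * real n powr (-1) \<le> p n \<and> p n < real n powr (- \<epsilon>)) \<longrightarrow>
    (\<lambda>n. measure_pmf.prob (Gnp n (p n))
       {E. c * ((real n)\<^sup>2 * ln (real n) / (real (independence_number {..<n} E))\<^sup>2)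
             \<le> real (theta1_bar {..<n} E) \<and>
           real (theta1_bar {..<n} E)
             \<le> C * ((real n)\<^sup>2 * ln (real n) / (real (independence_number {..<n} E))\<^sup>2)})
      \<longlonglongrightarrow> 1"
proof -
  have lim: "(\<lambda>n. measure_pmf.prob (Gnp n (p n))
       {E. \<epsilon> / 49152 * ((real n)\<^sup>2 * ln (real n) / (real (independence_number {..<n} E))\<^sup>2)
             \<le> real (theta1_bar {..<n} E) \<and>
           real (theta1_bar {..<n} E)
             \<le> 21233664 * ((real n)\<^sup>2 * ln (real n) / (real (independence_number {..<n} E))\<^sup>2)})
      \<longlonglongrightarrow> 1"
    if range: "\<forall>\<^sub>F n in sequentially.
      ln (real n) powr (2 + \<epsilon>) * real n powr (-1) \<le> p n \<and> p n < real n powr (- \<epsilon>)" for p :: "nat \<Rightarrow> real"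
  proof -
  define X where "X n = {E. \<epsilon> / 49152 * ((real n)\<^sup>2 * ln (real n) / (real (independence_number {..<n} E))\<^sup>2)
             \<le> real (theta1_bar {..<n} E) \<and>
           real (theta1_bar {..<n} E)
             \<le> 21233664 * ((real n)\<^sup>2 * ln (real n) / (real (independence_number {..<n} E))\<^sup>2)}" for n
  have ev: "\<forall>\<^sub>F n in sequentially. 1 \<le> ln (real n)" "\<forall>\<^sub>F n in sequentially. 32 \<le> \<epsilon> * real n"
    "\<forall>\<^sub>F n in sequentially. real n powr (- \<epsilon>) \<le> 1 / 2"
    using assms by real_asymp+
  \<comment> \<open>Only the square of the logarithm is kept from the lower bound on
    \<open>p\<close>. It gives both \<open>n * p n \<longlonglongrightarrow> \<infinity>\<close> and
    \<open>ln n \<le> sqrt (n * p n)\<close>.\<close>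
  have deg: "\<forall>\<^sub>F n in sequentially. (ln (real n))\<^sup>2 \<le> n * p n"
    using range ev(1)
  proof eventually_elim
    case (elim n)
    then have n0: "0 < real n" by (cases "n = 0") auto
    have "(ln (real n))\<^sup>2 = ln (real n) powr 2" using elim by (simp add: powr_numeral)
    also have "\<dots> \<le> ln (real n) powr (2 + \<epsilon>)" using elim assms by (intro powr_mono) auto
    also have "\<dots> = n * (ln (real n) powr (2 + \<epsilon>) * real n powr (-1))"
      using n0 by (simp add: powr_minus field_simps)
    also have "\<dots> \<le> n * p n" using elim by (intro mult_left_mono) auto
    finally show ?case .
  qed
  have "filterlim (\<lambda>n. (ln (real n))\<^sup>2) at_top sequentially" by real_asymp
  then have d_top: "filterlim (\<lambda>n. n * p n) at_top sequentially"
    using deg by (rule filterlim_at_top_mono)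
  have "\<forall>\<^sub>F n in sequentially. sparse_regime n (p n) \<epsilon>"
    using range ev deg eventually_compose_filterlim[OF eventually_large_degree d_top]
  proof eventually_elim
    case (elim n)
    have n0: "0 < real n" using elim by (cases "n = 0") auto
    have "0 < real n * p n" using elim by (simp add: large_degree_def)
    then have p0: "0 < p n" using n0 by (simp add: zero_less_mult_iff)
    have "ln (p n) \<le> ln (real n powr (- \<epsilon>))" using elim p0 n0 by (subst ln_le_cancel_iff) auto
    also have "\<dots> = - \<epsilon> * ln n" using n0 by (simp add: ln_powr)
    finally have lnp: "ln (p n) \<le> - \<epsilon> * ln n" .
    have "ln n \<le> sqrt (n * p n)" using elim by (intro real_le_rsqrt) auto
    then show ?case using elim p0 lnp assms by unfold_locales auto
  qed
  then have lower: "\<forall>\<^sub>F n in sequentially. 1 - 5 / (n * p n) \<le> measure_pmf.prob (Gnp n (p n)) (X n)"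
  proof eventually_elim
    case (elim n)
    interpret sparse_regime n "p n" \<epsilon> by (rule elim)
    have "1 - 5 / d \<le> subset_prob (p n) A typical" by (rule prob_typical)
    also have "\<dots> \<le> subset_prob (p n) A (\<lambda>E. E \<in> X n)"
      using p0 typical_bounds by (intro subset_prob_mono) (auto simp: X_def)
    also have "\<dots> = measure_pmf.prob (Gnp n (p n)) (X n)"
      unfolding Gnp_def A_def using p0 by (intro prob_bernoulli_subset[symmetric]) (auto simp: finite_vertex_pairs)
    finally show ?case by (simp add: d_def)
  qed
  have "((\<lambda>d::real. 1 - 5 / d) \<longlongrightarrow> 1) at_top" by real_asymp
  then have lower_lim: "(\<lambda>n. 1 - 5 / (n * p n)) \<longlonglongrightarrow> 1" using d_top by (rule filterlim_compose)
  \<comment> \<open>Squeezed between \<open>1 - 5 / (n * p n)\<close> and 1.\<close>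
  have "(\<lambda>n. measure_pmf.prob (Gnp n (p n)) (X n)) \<longlonglongrightarrow> 1"
    by (rule tendsto_sandwich[OF lower _ lower_lim tendsto_const]) simp
  then show ?thesis by (simp add: X_def)
  qed
  show ?thesis
    by (rule exI[of _ "\<epsilon> / 49152"], rule conjI, use assms in simp,
        rule exI[of _ 21233664], rule conjI, simp, intro allI impI, rule lim)
qed

end
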